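(* Let $q\in\mathcal{H}^2$. For all $n,m\in\{1,\dots,N-1\}$, $$d_q\nu_n\wedge d_q\nu_m=0,\qquad d_q\psi_{1,n}\wedge d_q\psi_{1,m}=0,\qquad d_q\psi_{1,n}\wedge d_q\nu_m=2\delta_{n,m},$$ where $\delta_{n,m}$ is the Kronecker symbol. In particular, the vectors $d_q\nu_n,\ d_q\psi_{1,n}$, $n=1,\dots,N-1$, form a basis of $\mathcal{H}^2$.
   Context: Let $N\in\mathbb{N}$, and write $\mathbb{Z}_m=\{1,\dots,m\}$. Let $\mathcal{H}=\{b\in\mathbb{R}^N:\sum_{n=1}^N b_n=0\}$ and $q=(x,b)=(x_n,b_n)_{n\in\mathbb{Z}_N}\in\mathcal{H}^2$ (so $x\in\mathcal{H}$ and $b\in\mathcal{H}$). Put $a_n=e^{x_n}>0$ and extend $a_n,b_n$ to all $n\in\mathbb{Z}$ as $N$-periodic sequences (in particular $a_0=a_N$). Let $\varphi=(\varphi_n(\lambda,q))_{n\in\mathbb{Z}}$ be the solution of $a_{n-1}y_{n-1}+b_ny_n+a_ny_{n+1}=\lambda y_n$, $(\lambda,n)\in\mathbb{C}\times\mathbb{Z}$, with $\varphi_0=0$, $\varphi_1=1$. The Dirichlet eigenvalues $\nu_1(q)<\dots<\nu_{N-1}(q)$ are the zeros of the polynomial $\lambda\mapsto\varphi_N(\lambda,q)$ (they are real and simple). The norming constants are $\psi_{1,n}(q)=\log\bigl((-1)^{N-n}\varphi_{N+1}(\nu_n(q),q)\bigr)$, $n\in\mathbb{Z}_{N-1}$ (the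 argument of the logarithm is positive). The functions $\nu_n,\psi_{1,n}$ are real analytic on $\mathcal{H}^2$. For a real analytic function $f:\mathcal{H}^2\to\mathbb{R}$, $d_qf\in\mathcal{H}^2\subset\mathbb{R}^{2N}$ denotes its gradient at $q$: the unique vector of $\mathcal{H}^2$ whose Euclidean inner product with each $v\in\mathcal{H}^2$ equals the derivative of $f$ at $q$ in the direction $v$. It is written $(f_{1,k},f_{2,k})_{k\in\mathbb{Z}_N}$, where the first entries correspond to the $x_k$-directions and the second entries to the $b_k$-directions. The form $\wedge$ is defined, for $f=(f_{1,n},f_{2,n})_{n\in\mathbb{Z}_N}$ and $g=(g_{1,n},g_{2,n})_{n\in\mathbb{Z}_N}$ in $\mathbb{C}^{2N}$, with $f_{1,0}:=f_{1,N}$ and $g_{1,0}:=g_{1,N}$, by $$f\wedge g=\sum_{n=1}^N\Bigl[(f_{1,n}g_{2,n}-f_{2,n}g_{1,n})-(f_{1,n-1}g_{2,n}-f_{2,n}g_{1,n-1})\Bigr].$$ *)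

theory Defs
  imports "HOL-Analysis.Analysis"
begin

text \<open>
  The number \<open>N\<close> of sites is the cardinality of the index type \<open>'n\<close>; every \<open>N \<ge> 1\<close> arises this
  way. The type is only assumed to be linearly ordered, and the elements of \<open>'n\<close> in increasing
  order play the role of \<open>1, \<dots>, N\<close>. The function \<open>site\<close> sends \<open>i \<in> {1..N}\<close> to the \<open>i\<close>-th element
  and is extended \<open>N\<close>-periodically, so that \<open>v $ site i\<close> is the periodic extension of \<open>v\<close>.
\<close>

definition site :: "int \<Rightarrow> 'n::{finite,linorder}" where
  "site i = sorted_list_of_set (UNIV :: 'n set) ! nat ((i - 1) mod int CARD('n))"

lemma site_periodic: "(site (i + int CARD('n)) :: 'n::{finite,linorder}) = site i"
proof -
  have "(i + int CARD('n) - 1) mod int CARD('n) = (i - 1) mod int CARD('n)"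
    by (metis add_diff_eq add.commute diff_add_eq mod_add_self2)
  then show ?thesis by (simp add: site_def)
qed

lemma bij_betw_site:
  "bij_betw (site :: int \<Rightarrow> 'n::{finite,linorder}) {1..int CARD('n)} UNIV"
proof -
  let ?xs = "sorted_list_of_set (UNIV :: 'n set)"
  have len: "length ?xs = CARD('n)" by simp
  have 1: "bij_betw (\<lambda>i. nat (i - 1)) {1..int CARD('n)} {..<CARD('n)}"
    by (rule bij_betw_byWitness[where f' = "\<lambda>k. int k + 1"]) auto
  have 2: "bij_betw (\<lambda>k. ?xs ! k) {..<CARD('n)} (UNIV :: 'n set)"
    by (rule bij_betw_nth) (use len in auto)
  have "bij_betw ((\<lambda>k. ?xs ! k) \<circ> (\<lambda>i. nat (i - 1))) {1..int CARD('n)} UNIV"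
    using bij_betw_trans[OF 1 2] .
  moreover have "site i = ((\<lambda>k. ?xs ! k) \<circ> (\<lambda>i. nat (i - 1))) i" if "i \<in> {1..int CARD('n)}" for i
    using that by (simp add: site_def)
  ultimately show ?thesis
    by (metis (no_types, lifting) bij_betw_cong)
qed

type_synonym ('a, 'n) vec_pair = "('a^'n) \<times> ('a^'n)"
type_synonym 'n phase = "(real, 'n) vec_pair"

definition H :: "(real^'n::finite) set" where
  "H = {b. (\<Sum>i\<in>UNIV. b $ i) = 0}"

definition H2 :: "'n::finite phase set" where
  "H2 = H \<times> H"

definition acoef :: "'n::{finite,linorder} phase \<Rightarrow> int \<Rightarrow> real" where
  "acoef q i = exp (fst q $ site i)"

definition bcoef :: "'n::{finite,linorder} phase \<Rightarrow> int \<Rightarrow> real" where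
  "bcoef q i = snd q $ site i"

definition is_phi :: "'n::{finite,linorder} phase \<Rightarrow> complex \<Rightarrow> (int \<Rightarrow> complex) \<Rightarrow> bool" where
  "is_phi q l y \<longleftrightarrow> y 0 = 0 \<and> y 1 = 1 \<and>
     (\<forall>i. of_real (acoef q (i - 1)) * y (i - 1) + of_real (bcoef q i) * y i
          + of_real (acoef q i) * y (i + 1) = l * y i)"

definition phi :: "'n::{finite,linorder} phase \<Rightarrow> complex \<Rightarrow> int \<Rightarrow> complex" where
  "phi q l = (THE y. is_phi q l y)"

lemma ex1_is_phi:
  fixes q :: "'n::{finite,linorder} phase"
  shows "\<exists>!y. is_phi q l y"
proof -
  define A where "A i = complex_of_real (acoef q i)" for i
  define B where "B i = complex_of_real (bcoef q i)" for i
  have A0: "A i \<noteq> 0" for i by (simp add: A_def acoef_def)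
  define F where "F = rec_nat (0, 1) (\<lambda>k p. (snd p,
      ((l - B (int k + 1)) * snd p - A (int k) * fst p) / A (int k + 1)))"
  define G where "G = rec_nat (0, 1) (\<lambda>k p. (
      ((l - B (- int k)) * fst p - A (- int k) * snd p) / A (- int k - 1), fst p))"
  define y where "y i = (if i \<ge> 0 then fst (F (nat i)) else fst (G (nat (- i))))" for i
  have F0: "F 0 = (0, 1)" and G0: "G 0 = (0, 1)" by (simp_all add: F_def G_def)
  have FS: "F (Suc k) = (snd (F k),
      ((l - B (int k + 1)) * snd (F k) - A (int k) * fst (F k)) / A (int k + 1))" for k
    by (simp add: F_def)
  have GS: "G (Suc k) = (((l - B (- int k)) * fst (G k) - A (- int k) * snd (G k))
      / A (- int k - 1), fst (G k))" for k
    by (simp add: G_def)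
  have y0: "y 0 = 0" and y1: "y 1 = 1" by (simp_all add: y_def F0 FS)
  have yF: "F k = (y (int k), y (int k + 1))" for k
    by (cases "F k") (simp add: y_def nat_add_distrib FS)
  have yG: "G k = (y (- int k), y (1 - int k))" for k
  proof (cases k)
    case 0
    then show ?thesis by (simp add: G0 y0 y1)
  next
    case (Suc j)
    have "snd (G k) = fst (G j)" by (simp add: Suc GS)
    also have "\<dots> = y (- int j)" by (cases j) (simp_all add: y_def F0 G0 nat_add_distrib)
    finally show ?thesis by (cases "G k") (simp add: Suc y_def nat_add_distrib)
  qed
  have eq: "A (i - 1) * y (i - 1) + B i * y i + A i * y (i + 1) = l * y i" for i
  proof (cases "i \<ge> 1")
    case True
    define k where "k = nat (i - 1)"
    have i: "i = int k + 1" using True by (simp add: k_def)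
    have "y (i + 1) = ((l - B i) * y i - A (i - 1) * y (i - 1)) / A i"
      using FS[of k] unfolding yF i by (simp add: add.commute)
    then show ?thesis using A0[of i] by (simp add: field_simps)
  next
    case False
    define k where "k = nat (- i)"
    have i: "i = - int k" using False by (simp add: k_def)
    have "y (i - 1) = ((l - B i) * y i - A i * y (i + 1)) / A (i - 1)"
      using GS[of k] minus_diff_commute[of 1 "int k"] unfolding yG i by (simp add: add.commute)
    then show ?thesis using A0[of "i - 1"] by (simp add: field_simps)
  qed
  show ?thesis
  proof (rule ex1I[of _ y])
    show "is_phi q l y" using y0 y1 eq by (simp add: is_phi_def A_def B_def)
  next
    fix z assume "is_phi q l z"
    then have z0: "z 0 = 0" and z1: "z 1 = 1"
      and ez: "A (i - 1) * z (i - 1) + B i * z i + A i * z (i + 1) = l * z i" for i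
      by (simp_all add: is_phi_def A_def B_def)
    have zu: "A j * z (j + 1) = l * z j - B j * z j - A (j - 1) * z (j - 1)" for j
      unfolding ez[of j, symmetric] by simp
    have yu: "A j * y (j + 1) = l * y j - B j * y j - A (j - 1) * y (j - 1)" for j
      unfolding eq[of j, symmetric] by simp
    have zd: "A (j - 1) * z (j - 1) = l * z j - B j * z j - A j * z (j + 1)" for j
      unfolding ez[of j, symmetric] by simp
    have yd: "A (j - 1) * y (j - 1) = l * y j - B j * y j - A j * y (j + 1)" for j
      unfolding eq[of j, symmetric] by simp
    have up: "z (int k) = y (int k) \<and> z (int k + 1) = y (int k + 1)" for k
    proof (induction k)
      case (Suc k)
      have "A (int k + 1) * z (int k + 1 + 1) = A (int k + 1) * y (int k + 1 + 1)"
        unfolding zu yu using Suc by simp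
      then show ?case using Suc A0 by (simp add: add.commute)
    qed (simp add: z0 z1 y0 y1)
    have down: "z (- int k) = y (- int k) \<and> z (- int k + 1) = y (- int k + 1)" for k
    proof (induction k)
      case (Suc k)
      have "A (- int k - 1) * z (- int k - 1) = A (- int k - 1) * y (- int k - 1)"
        unfolding zd yd using Suc by simp
      then have "z (- int k - 1) = y (- int k - 1)" using A0 by simp
      moreover have "- int (Suc k) = - int k - 1" by simp
      ultimately show ?case using Suc by (metis diff_add_cancel)
    qed (simp add: z0 z1 y0 y1)
    show "z = y"
    proof
      fix i show "z i = y i" using up down by (cases i rule: int_cases2) auto
    qed
  qed
qed

lemma is_phi_phi: "is_phi q l (phi q l)"
  unfolding phi_def by (rule theI'[OF ex1_is_phi])

text \<open>
  The zeros of \<open>\<phi>\<^sub>N\<close> are real and simple, so that the \<open>n\<close>-th Dirichlet eigenvalue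
  is the \<open>n\<close>-th element of the increasingly sorted list of real zeros. At real \<open>\<lambda>\<close> the values of \<open>\<phi>\<close>
  are real, hence \<open>Re\<close> in the norming constants is only a change of type.
\<close>

definition nu :: "nat \<Rightarrow> 'n::{finite,linorder} phase \<Rightarrow> real" where
  "nu n q = sorted_list_of_set {l::real. phi q (of_real l) (int CARD('n)) = 0} ! (n - 1)"

definition psi1 :: "nat \<Rightarrow> 'n::{finite,linorder} phase \<Rightarrow> real" where
  "psi1 n q = ln ((-1) ^ (CARD('n) - n) * Re (phi q (of_real (nu n q)) (int CARD('n) + 1)))"

definition is_grad :: "('n::finite phase \<Rightarrow> real) \<Rightarrow> 'n phase \<Rightarrow> 'n phase \<Rightarrow> bool" where
  "is_grad f q w \<longleftrightarrow> w \<in> H2 \<and>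
     (\<forall>v\<in>H2. ((\<lambda>t. f (q + t *\<^sub>R v)) has_real_derivative (w \<bullet> v)) (at 0))"

definition grad :: "('n::finite phase \<Rightarrow> real) \<Rightarrow> 'n phase \<Rightarrow> 'n phase" where
  "grad f q = (THE w. is_grad f q w)"

lemma is_grad_unique:
  assumes "is_grad f q w" and "is_grad f q w'"
  shows "w = w'"
proof -
  have "w - w' \<in> H2"
    using assms by (auto simp: is_grad_def H2_def H_def sum_subtractf)
  then have "w \<bullet> (w - w') = w' \<bullet> (w - w')"
    using assms unfolding is_grad_def by (meson DERIV_unique)
  then have "(w - w') \<bullet> (w - w') = 0"
    by (simp add: inner_diff_left)
  then show ?thesis by simp
qed

lemma grad_eqI: "is_grad f q w \<Longrightarrow> grad f q = w"
  unfolding grad_def using is_grad_unique by (blast intro: the_equality)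

text \<open>
  The form makes sense over any commutative ring of scalars; it is applied to real gradients.
\<close>

definition wedge ::
  "('a::comm_ring_1, 'n::{finite,linorder}) vec_pair \<Rightarrow> ('a, 'n) vec_pair \<Rightarrow> 'a" where
  "wedge f g = (\<Sum>i = 1..int CARD('n).
      (fst f $ site i * snd g $ site i - snd f $ site i * fst g $ site i)
    - (fst f $ site (i - 1) * snd g $ site i - snd f $ site i * fst g $ site (i - 1)))"

text \<open>
  A basis as an indexed family, so that coinciding members are excluded.
\<close>

definition basis_family :: "'i set \<Rightarrow> ('i \<Rightarrow> 'v::real_vector) \<Rightarrow> 'v set \<Rightarrow> bool" where
  "basis_family I e V \<longleftrightarrow> inj_on e I \<and> independent (e ` I) \<and> span (e ` I) = V"

end

theory Submission
  imports Defs "HOL-Computational_Algebra.Fundamental_Theorem_Algebra"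
begin

text \<open>
  Fix \<open>q\<close>, write \<open>y\<close> for the Dirichlet eigenvector at \<open>\<nu> = \<nu>\<^sub>n\<close> with \<open>y\<^sub>0 = 0\<close>, \<open>y\<^sub>1 = 1\<close>, \<open>y\<^sub>N = 0\<close>, and
  \<open>\<theta>\<close> for the solution at \<open>\<nu>\<close> that is orthogonal to \<open>y\<close> and has the Wronskian
  \<open>a\<^sub>k (\<theta>\<^sub>k y\<^sub>k\<^sub>+\<^sub>1 - \<theta>\<^sub>k\<^sub>+\<^sub>1 y\<^sub>k) = - 1\<close>. To solutions \<open>u, v\<close> at the same spectral parameter belongs the product
  \<open>P(u, v)\<close> with first entries \<open>a\<^sub>k (u\<^sub>k v\<^sub>k\<^sub>+\<^sub>1 + u\<^sub>k\<^sub>+\<^sub>1 v\<^sub>k)\<close> and second entries \<open>u\<^sub>k v\<^sub>k\<close>. First-order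
  perturbation theory, in the form of Green's formula for the recurrence, shows that up to the
  orthogonal projection onto \<open>H2\<close> the gradient of \<open>\<nu>\<^sub>n\<close> is \<open>P(y / \<parallel>y\<parallel>\<^sup>2, y)\<close> and the gradient of
  \<open>\<psi>\<^sub>1\<^sub>,\<^sub>n\<close> is \<open>P(\<theta>, y)\<close> (\<open>grad_nu\<close>, \<open>grad_psi1\<close>). The projection subtracts constants, which lie in the
  kernel of \<open>\<wedge>\<close> (\<open>wedge_site_vec\<close>).

  For products at two spectral parameters \<open>\<lambda>, \<mu>\<close> the expression \<open>(\<lambda> - \<mu>) P(u, v) \<wedge> P(w, z)\<close> telescopes to
  the boundary values of \<open>[u, w] [v, z] + [u, z] [v, w]\<close>, where the brackets are Wronskians
  (\<open>bracket_products\<close>). In all cases at hand \<open>v\<close> and \<open>z\<close> are Dirichlet eigenvectors, and the boundary values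
  at the two ends cancel because the Wronskians of \<open>u, v\<close> and of \<open>w, z\<close> are constant. At equal
  parameters \<open>P(\<theta>, y) \<wedge> P(y, y)\<close> is \<open>- 2\<close> times the Wronskian of \<open>\<theta>, y\<close> times \<open>\<parallel>y\<parallel>\<^sup>2\<close>, that is
  \<open>2 \<parallel>y\<parallel>\<^sup>2\<close> (\<open>bracket_products_same\<close>). The basis property follows, since the relations make the gradients
  independent, and there are \<open>2 (N - 1) = dim H2\<close> of them.

  What remains is that the \<open>n\<close>-th eigenvalue is a differentiable function. The polynomial \<open>\<phi>\<^sub>N\<close> has
  exactly \<open>N - 1\<close> real roots, all simple (\<open>dirichlet_spectrum\<close>). Its factorization makes the ordered roots
  continuous along lines (\<open>tendsto_sorted_roots\<close>), and Green's formula for two neighbouring recurrences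
  improves continuity to differentiability (\<open>eigenvalue_derivative\<close>).
\<close>

section \<open>The three-term recurrence\<close>

text \<open>
  The inhomogeneity \<open>h\<close> makes room for sequences that solve the recurrence up to a known defect,
  such as the derivative of a solution in the spectral parameter or in the coefficients.
\<close>

definition jacobi_eq ::
  "(nat \<Rightarrow> 'a::field) \<Rightarrow> (nat \<Rightarrow> 'a) \<Rightarrow> 'a \<Rightarrow> (nat \<Rightarrow> 'a) \<Rightarrow> (nat \<Rightarrow> 'a) \<Rightarrow> bool" where
  "jacobi_eq a b l h y \<longleftrightarrow>
     (\<forall>k. a k * y k + b (Suc k) * y (Suc k) + a (Suc k) * y (Suc (Suc k))
          = l * y (Suc k) + h (Suc k))"

definition wronskian ::
  "(nat \<Rightarrow> 'a::field) \<Rightarrow> (nat \<Rightarrow> 'a) \<Rightarrow> (nat \<Rightarrow> 'a) \<Rightarrow> nat \<Rightarrow> 'a" where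
  "wronskian a y z k = a k * (y k * z (Suc k) - y (Suc k) * z k)"

fun jacobi_sol :: "(nat \<Rightarrow> 'a::field) \<Rightarrow> (nat \<Rightarrow> 'a) \<Rightarrow> 'a \<Rightarrow> 'a \<Rightarrow> 'a \<Rightarrow> nat \<Rightarrow> 'a" where
  "jacobi_sol a b l s t 0 = s"
| "jacobi_sol a b l s t (Suc 0) = t"
| "jacobi_sol a b l s t (Suc (Suc k)) =
     ((l - b (Suc k)) * jacobi_sol a b l s t (Suc k) - a k * jacobi_sol a b l s t k) / a (Suc k)"

lemma jacobi_sol_eq:
  assumes "\<And>k. a k \<noteq> 0"
  shows "jacobi_eq a b l (\<lambda>_. 0) (jacobi_sol a b l s t)"
  using assms by (simp add: jacobi_eq_def left_diff_distrib)

lemma jacobi_eq_scale: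
  "jacobi_eq a b l (\<lambda>_. 0) y \<Longrightarrow> jacobi_eq a b l (\<lambda>_. 0) (\<lambda>k. c * y k)"
  unfolding jacobi_eq_def
proof
  fix k assume "\<forall>k. a k * y k + b (Suc k) * y (Suc k) + a (Suc k) * y (Suc (Suc k)) = l * y (Suc k) + 0"
  then have "c * (a k * y k + b (Suc k) * y (Suc k) + a (Suc k) * y (Suc (Suc k)))
    = c * (l * y (Suc k) + 0)" by simp
  then show "a k * (c * y k) + b (Suc k) * (c * y (Suc k)) + a (Suc k) * (c * y (Suc (Suc k)))
      = l * (c * y (Suc k)) + 0"
    by (simp add: algebra_simps)
qed

lemma jacobi_eq_diff:
  assumes "jacobi_eq a b l (\<lambda>_. 0) y" and "jacobi_eq a b l (\<lambda>_. 0) z"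
  shows "jacobi_eq a b l (\<lambda>_. 0) (\<lambda>k. y k - z k)"
  unfolding jacobi_eq_def
proof
  fix k
  have "(a k * y k + b (Suc k) * y (Suc k) + a (Suc k) * y (Suc (Suc k)))
      - (a k * z k + b (Suc k) * z (Suc k) + a (Suc k) * z (Suc (Suc k)))
      = l * y (Suc k) - l * z (Suc k)"
    using assms by (simp add: jacobi_eq_def)
  then show "a k * (y k - z k) + b (Suc k) * (y (Suc k) - z (Suc k))
      + a (Suc k) * (y (Suc (Suc k)) - z (Suc (Suc k))) = l * (y (Suc k) - z (Suc k)) + 0"
    by (simp add: algebra_simps)
qed

lemma wronskian_step:
  assumes "jacobi_eq a b l (\<lambda>_. 0) y" and "jacobi_eq a b m h z"
  shows "wronskian a y z (Suc k) - wronskian a y z k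
           = y (Suc k) * ((m - l) * z (Suc k) + h (Suc k))"
proof -
  have y: "a (Suc k) * y (Suc (Suc k)) = l * y (Suc k) - a k * y k - b (Suc k) * y (Suc k)"
    and z: "a (Suc k) * z (Suc (Suc k))
              = m * z (Suc k) + h (Suc k) - a k * z k - b (Suc k) * z (Suc k)"
    using assms by (simp_all add: jacobi_eq_def eq_diff_eq ac_simps)
  have "wronskian a y z (Suc k)
      = y (Suc k) * (a (Suc k) * z (Suc (Suc k))) - (a (Suc k) * y (Suc (Suc k))) * z (Suc k)"
    by (simp add: wronskian_def algebra_simps)
  also have "\<dots> = y (Suc k) * ((m - l) * z (Suc k) + h (Suc k)) + wronskian a y z k"
    unfolding y z by (simp add: wronskian_def algebra_simps)
  finally show ?thesis by simp
qed

text \<open>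
  The discrete Green formula, the common source of all spectral facts below: with a conjugate
  solution it gives reality of the spectrum, with the \<open>\<lambda>\<close>-derivative its simplicity, and with
  solutions of neighbouring recurrences the derivatives of the spectral data.
\<close>

lemma green:
  assumes "jacobi_eq a b l (\<lambda>_. 0) y" and "jacobi_eq a b m h z"
  shows "wronskian a y z n - wronskian a y z 0
           = (\<Sum>k<n. y (Suc k) * ((m - l) * z (Suc k) + h (Suc k)))"
  by (simp add: sum_lessThan_telescope[symmetric] wronskian_step[OF assms])

lemma wronskian_constant:
  assumes "jacobi_eq a b l (\<lambda>_. 0) y" and "jacobi_eq a b l (\<lambda>_. 0) z"
  shows "wronskian a y z n = wronskian a y z 0"
  using green[OF assms, of n] by simp

lemma sum_squares_pos:
  fixes y :: "nat \<Rightarrow> real"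
  assumes "y 1 \<noteq> 0"
  shows "(\<Sum>k<Suc n. y (Suc k) * y (Suc k)) > 0"
proof -
  have "0 < y (Suc 0) * y (Suc 0)" using assms by (auto simp: zero_less_mult_iff)
  also have "\<dots> \<le> (\<Sum>k<Suc n. y (Suc k) * y (Suc k))"
    using member_le_sum[of 0 "{..<Suc n}" "\<lambda>k. y (Suc k) * y (Suc k)"] by auto
  finally show ?thesis .
qed

section \<open>The Dirichlet spectrum\<close>

text \<open>
  The solution with initial values \<open>0, 1\<close> as a polynomial in the spectral parameter. It is taken over
  an arbitrary field because the roots are located over the complex numbers.
\<close>

fun jacobi_poly :: "(nat \<Rightarrow> 'a::field) \<Rightarrow> (nat \<Rightarrow> 'a) \<Rightarrow> nat \<Rightarrow> 'a poly" where
  "jacobi_poly a b 0 = 0"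
| "jacobi_poly a b (Suc 0) = 1"
| "jacobi_poly a b (Suc (Suc k)) = smult (inverse (a (Suc k)))
     ([:- b (Suc k), 1:] * jacobi_poly a b (Suc k) - smult (a k) (jacobi_poly a b k))"

lemma poly_jacobi_poly: "poly (jacobi_poly a b k) l = jacobi_sol a b l 0 1 k"
  by (induction a b k rule: jacobi_poly.induct) (simp_all add: divide_inverse algebra_simps)

lemma degree_jacobi_poly: "degree (jacobi_poly a b k) \<le> k - 1"
proof (induction a b k rule: jacobi_poly.induct)
  case (3 a b k)
  have "degree ([:- b (Suc k), 1:] * jacobi_poly a b (Suc k)) \<le> Suc k"
    using degree_mult_le[of "[:- b (Suc k), 1:]" "jacobi_poly a b (Suc k)"] 3 by simp
  moreover have "degree (jacobi_poly a b k) \<le> Suc k"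
    using 3 by linarith
  ultimately show ?case
    unfolding jacobi_poly.simps diff_Suc_1
    by (intro order_trans[OF degree_smult_le] degree_diff_le)
qed simp_all

text \<open>
  Each step of the recurrence multiplies the leading term by \<open>\<lambda> / a\<^sub>k\<close>.
\<close>

lemma coeff_jacobi_poly:
  assumes "\<And>k. a k \<noteq> 0"
  shows "(\<Prod>k<n. a (Suc k)) * coeff (jacobi_poly a b (Suc n)) n = 1"
proof (induction n)
  case (Suc n)
  have "coeff (jacobi_poly a b n) (Suc n) = 0" "coeff (jacobi_poly a b (Suc n)) (Suc n) = 0"
    using degree_jacobi_poly[of a b n] degree_jacobi_poly[of a b "Suc n"]
    by (auto intro!: coeff_eq_0)
  then have "coeff (jacobi_poly a b (Suc (Suc n))) (Suc n)
      = inverse (a (Suc n)) * coeff (jacobi_poly a b (Suc n)) n"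
    by simp
  then have "(\<Prod>k<Suc n. a (Suc k)) * coeff (jacobi_poly a b (Suc (Suc n))) (Suc n)
      = (\<Prod>k<n. a (Suc k)) * coeff (jacobi_poly a b (Suc n)) n * (a (Suc n) * inverse (a (Suc n)))"
    by (simp add: ac_simps del: jacobi_poly.simps)
  then show ?case using Suc assms[of "Suc n"] by simp
qed simp

text \<open>
  Differentiating the recurrence in \<open>\<lambda>\<close> leaves the solution itself as inhomogeneity.
\<close>

lemma jacobi_eq_pderiv:
  assumes "\<And>k. a k \<noteq> 0"
  shows "jacobi_eq a b l (jacobi_sol a b l 0 1) (\<lambda>k. poly (pderiv (jacobi_poly a b k)) l)"
  unfolding jacobi_eq_def
proof
  fix k
  have inv: "a (Suc k) * (inverse (a (Suc k)) * x) = x" for x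
    using assms[of "Suc k"] by simp
  show "a k * poly (pderiv (jacobi_poly a b k)) l
      + b (Suc k) * poly (pderiv (jacobi_poly a b (Suc k))) l
      + a (Suc k) * poly (pderiv (jacobi_poly a b (Suc (Suc k)))) l
      = l * poly (pderiv (jacobi_poly a b (Suc k))) l + jacobi_sol a b l 0 1 (Suc k)"
    by (simp add: pderiv_smult pderiv_mult pderiv_diff pderiv_pCons poly_jacobi_poly inv
          del: mult_pCons_left) (simp add: algebra_simps)
qed

lemma jacobi_sol_of_real:
  "jacobi_sol (\<lambda>k. of_real (a k)) (\<lambda>k. of_real (b k)) (of_real l) (of_real s) (of_real t) k
     = (of_real (jacobi_sol a b l s t k) :: 'a::{real_field})"
  by (induction a b l s t k rule: jacobi_sol.induct) simp_all

text \<open>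
  Self-adjointness: the conjugate of a solution at \<open>l\<close> solves the recurrence at \<open>cnj l\<close>. When both
  vanish at the two ends, Green's formula leaves \<open>(cnj l - l) * \<Sum>\<bar>y\<^sub>k\<bar>\<^sup>2 = 0\<close>, and the sum is positive
  because \<open>y\<^sub>1 = 1\<close>.
\<close>

lemma dirichlet_root_real:
  fixes a b :: "nat \<Rightarrow> real" and l :: complex
  assumes a: "\<And>k. a k \<noteq> 0"
    and root: "jacobi_sol (\<lambda>k. of_real (a k)) (\<lambda>k. of_real (b k)) l 0 1 (Suc n) = 0"
  shows "l \<in> \<real>"
proof -
  define y where "y = jacobi_sol (\<lambda>k. complex_of_real (a k)) (\<lambda>k. of_real (b k)) l 0 1"
  have y: "jacobi_eq (\<lambda>k. of_real (a k)) (\<lambda>k. of_real (b k)) l (\<lambda>_. 0) y"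
    unfolding y_def by (rule jacobi_sol_eq) (simp add: a)
  have yN: "y (Suc n) = 0" using root by (simp add: y_def)
  have "jacobi_eq (\<lambda>k. of_real (a k)) (\<lambda>k. of_real (b k)) (cnj l) (\<lambda>_. 0) (\<lambda>k. cnj (y k))"
    unfolding jacobi_eq_def
  proof
    fix k
    have "cnj (of_real (a k) * y k + of_real (b (Suc k)) * y (Suc k)
            + of_real (a (Suc k)) * y (Suc (Suc k))) = cnj (l * y (Suc k) + 0)"
      using y unfolding jacobi_eq_def by metis
    then show "of_real (a k) * cnj (y k) + of_real (b (Suc k)) * cnj (y (Suc k))
            + of_real (a (Suc k)) * cnj (y (Suc (Suc k))) = cnj l * cnj (y (Suc k)) + 0"
      by simp
  qed
  from green[OF y this, of "Suc n"]
  have "(\<Sum>k<Suc n. y (Suc k) * ((cnj l - l) * cnj (y (Suc k)))) = 0"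
    using yN by (simp add: wronskian_def y_def)
  moreover have "(\<Sum>k<Suc n. y (Suc k) * ((cnj l - l) * cnj (y (Suc k))))
      = (cnj l - l) * of_real (\<Sum>k<Suc n. cmod (y (Suc k)) * cmod (y (Suc k)))"
    unfolding of_real_sum sum_distrib_left
    by (intro sum.cong refl)
       (simp add: complex_norm_square[unfolded power2_eq_square, of "y _", symmetric] algebra_simps
          flip: power2_eq_square complex_norm_square)
  moreover have "(\<Sum>k<Suc n. cmod (y (Suc k)) * cmod (y (Suc k))) > 0"
    by (rule sum_squares_pos) (simp add: y_def)
  ultimately have "cnj l = l" by (simp del: of_real_sum sum.lessThan_Suc)
  then show ?thesis by (simp add: Reals_cnj_iff)
qed

text \<open>
  At a double root the solution \<open>y\<close> and its \<open>\<lambda>\<close>-derivative would both vanish at the right end, so that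
  Green's formula for this pair would read \<open>0 = \<Sum>y\<^sub>k\<^sup>2\<close>.
\<close>

lemma dirichlet_root_simple:
  fixes a b :: "nat \<Rightarrow> real"
  assumes a: "\<And>k. a k \<noteq> 0"
    and root: "jacobi_sol a b l 0 1 (Suc n) = 0"
  defines "A \<equiv> \<lambda>k. complex_of_real (a k)" and "B \<equiv> \<lambda>k. complex_of_real (b k)"
  shows "poly (pderiv (jacobi_poly A B (Suc n))) (of_real l) \<noteq> 0"
proof
  assume z: "poly (pderiv (jacobi_poly A B (Suc n))) (of_real l) = 0"
  let ?y = "jacobi_sol A B (of_real l) 0 1"
  have A0: "A k \<noteq> 0" for k by (simp add: A_def a)
  have y: "?y k = of_real (jacobi_sol a b l 0 1 k)" for k
    using jacobi_sol_of_real[of a b l 0 1 k, where 'a=complex] by (simp add: A_def B_def)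
  have "jacobi_eq A B (of_real l) (\<lambda>_. 0) ?y"
    by (rule jacobi_sol_eq) (rule A0)
  moreover have "jacobi_eq A B (of_real l) ?y (\<lambda>k. poly (pderiv (jacobi_poly A B k)) (of_real l))"
    by (rule jacobi_eq_pderiv) (rule A0)
  ultimately have "(\<Sum>k<Suc n. ?y (Suc k) * ?y (Suc k)) = 0"
    using green[of A B "of_real l" ?y "of_real l" ?y
        "\<lambda>k. poly (pderiv (jacobi_poly A B k)) (of_real l)" "Suc n"] z root
    by (simp add: wronskian_def y del: jacobi_sol.simps(3) jacobi_poly.simps(3) sum.lessThan_Suc)
  then have "complex_of_real (\<Sum>k<Suc n. jacobi_sol a b l 0 1 (Suc k) * jacobi_sol a b l 0 1 (Suc k)) = 0"
    by (simp only: y of_real_mult of_real_sum)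
  then have "(\<Sum>k<Suc n. jacobi_sol a b l 0 1 (Suc k) * jacobi_sol a b l 0 1 (Suc k)) = 0"
    using of_real_eq_0_iff by blast
  with sum_squares_pos[of "jacobi_sol a b l 0 1" n] show False by simp
qed

text \<open>
  A complex polynomial of degree \<open>n\<close> with real simple roots only splits into \<open>n\<close> distinct real linear
  factors. The factorization is recorded as well, since it yields continuity of the roots.
\<close>

theorem dirichlet_spectrum:
  fixes a b :: "nat \<Rightarrow> real" and n :: nat
  assumes a: "\<And>k. a k \<noteq> 0"
  defines "R \<equiv> {x. jacobi_sol a b x 0 1 (Suc n) = 0}"
  shows "finite R" and "card R = n"
    and "(\<Prod>k<n. a (Suc k)) * jacobi_sol a b x 0 1 (Suc n) = (\<Prod>r\<in>R. x - r)"
proof -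
  define A B where "A = (\<lambda>k. complex_of_real (a k))" and "B = (\<lambda>k. complex_of_real (b k))"
  let ?p = "jacobi_poly A B (Suc n)"
  let ?c = "\<Prod>k<n. A (Suc k)"
  have A0: "A k \<noteq> 0" for k by (simp add: A_def a)
  have val: "poly ?p (of_real x) = of_real (jacobi_sol a b x 0 1 (Suc n))" for x
    using jacobi_sol_of_real[of a b x 0 1 "Suc n", where 'a=complex]
    by (simp add: A_def B_def poly_jacobi_poly)
  have c: "?c * coeff ?p n = 1" by (rule coeff_jacobi_poly) (rule A0)
  have deg: "degree ?p = n"
    using degree_jacobi_poly[of A B "Suc n"] le_degree[of ?p n] c by fastforce
  have roots: "{z. poly ?p z = 0} = of_real ` R"
  proof (intro equalityI subsetI)
    fix z assume z: "z \<in> {z. poly ?p z = 0}"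
    then have "z \<in> \<real>"
      using dirichlet_root_real[where a=a and b=b and l=z and n=n] a by (simp add: poly_jacobi_poly A_def B_def)
    then obtain x where "z = of_real x" by (auto elim: Reals_cases)
    then show "z \<in> of_real ` R" using z val[of x] by (auto simp: R_def)
  qed (auto simp: R_def val simp del: jacobi_poly.simps jacobi_sol.simps)
  have "rsquarefree ?p"
    unfolding rsquarefree_roots
  proof (intro allI notI)
    fix z assume z: "poly ?p z = 0 \<and> poly (pderiv ?p) z = 0"
    then obtain x where x: "z = of_real x" "x \<in> R" using roots by blast
    with dirichlet_root_simple[where a=a and b=b and l=x and n=n] a z show False by (simp add: R_def A_def B_def)
  qed
  then have dec: "smult (coeff ?p n) (\<Prod>z\<in>of_real ` R. [:- z, 1:]) = ?p"
    using complex_poly_decompose_rsquarefree[of ?p] by (simp add: deg roots)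
  show fin: "finite R"
  proof -
    have "?p \<noteq> 0" using c by auto
    then have "finite (complex_of_real ` R)" using poly_roots_finite[of ?p] roots by simp
    then show ?thesis by (rule finite_imageD) (auto intro: inj_onI)
  qed
  have "degree (\<Prod>z\<in>complex_of_real ` R. [:- z, 1:]) = card (complex_of_real ` R)"
    by (subst degree_prod_sum_eq) auto
  moreover have "degree (\<Prod>z\<in>complex_of_real ` R. [:- z, 1:]) = n"
  proof -
    have "coeff ?p n \<noteq> 0" using c by auto
    then show ?thesis using arg_cong[OF dec, of degree] deg by simp
  qed
  ultimately show "card R = n" by (simp add: card_image inj_on_def)
  have "poly ?p (of_real x) = coeff ?p n * (\<Prod>r\<in>R. of_real x - of_real r)"
    by (subst dec[symmetric]) (simp add: poly_prod prod.reindex inj_on_def)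
  then have "?c * poly ?p (of_real x) = (?c * coeff ?p n) * (\<Prod>r\<in>R. of_real x - of_real r)"
    by simp
  then have "complex_of_real ((\<Prod>k<n. a (Suc k)) * jacobi_sol a b x 0 1 (Suc n))
      = of_real (\<Prod>r\<in>R. x - r)"
    unfolding c val by (simp add: A_def)
  then show "(\<Prod>k<n. a (Suc k)) * jacobi_sol a b x 0 1 (Suc n) = (\<Prod>r\<in>R. x - r)"
    using of_real_eq_iff by blast
qed

section \<open>Continuity of ordered roots\<close>

lemma exists_gap:
  fixes S :: "real set"
  assumes "finite S"
  obtains d where "d > 0" and "\<And>x y. x \<in> S \<Longrightarrow> y \<in> S \<Longrightarrow> x < y \<Longrightarrow> 2 * d \<le> y - x"
proof -
  define D where "D = insert 1 ((\<lambda>(x, y). y - x) ` {(x, y). x \<in> S \<and> y \<in> S \<and> x < y})"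
  have "finite {(x, y). x \<in> S \<and> y \<in> S \<and> x < y}"
    by (rule finite_subset[of _ "S \<times> S"]) (use assms in auto)
  then have D: "finite D" "D \<noteq> {}" by (auto simp: D_def)
  show thesis
  proof
    show "Min D / 2 > 0" using D by (auto simp: D_def)
    fix x y assume "x \<in> S" "y \<in> S" "x < y"
    then have "y - x \<in> D" by (force simp: D_def)
    then show "2 * (Min D / 2) \<le> y - x" using D by simp
  qed
qed

text \<open>
  If all elements of \<open>R t\<close> had distance at least \<open>\<epsilon>\<close> from some \<open>x \<in> S\<close>, the product would be at least \<open>\<epsilon> ^ card S\<close> in absolute value. So for small \<open>\<epsilon>\<close> every
  \<open>x \<in> S\<close> has an element of \<open>R t\<close> within \<open>\<epsilon>\<close>; these elements are ordered like \<open>S\<close>, hence distinct,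
  and by counting they exhaust \<open>R t\<close>.
\<close>

lemma tendsto_sorted_roots:
  fixes R :: "'b \<Rightarrow> real set" and S :: "real set"
  assumes S: "finite S"
    and R: "eventually (\<lambda>t. finite (R t) \<and> card (R t) = card S) F"
    and lim: "\<And>x. x \<in> S \<Longrightarrow> ((\<lambda>t. \<Prod>r\<in>R t. x - r) \<longlongrightarrow> 0) F"
    and j: "j < card S"
  shows "((\<lambda>t. sorted_list_of_set (R t) ! j) \<longlongrightarrow> sorted_list_of_set S ! j) F"
proof (rule tendstoI)
  fix e :: real assume "e > 0"
  obtain d where d: "d > 0" "\<And>x y. x \<in> S \<Longrightarrow> y \<in> S \<Longrightarrow> x < y \<Longrightarrow> 2 * d \<le> y - x"
    using exists_gap[OF S] by blast
  define \<epsilon> where "\<epsilon> = min d e"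
  have eps: "\<epsilon> > 0" "\<epsilon> \<le> d" "\<epsilon> \<le> e" using d \<open>e > 0\<close> by (auto simp: \<epsilon>_def)
  have ev: "eventually (\<lambda>t. \<forall>x\<in>S. \<bar>\<Prod>r\<in>R t. x - r\<bar> < \<epsilon> ^ card S) F"
    using S
  proof (rule eventually_ball_finite, intro ballI)
    fix x assume "x \<in> S"
    from tendstoD[OF lim[OF this], of "\<epsilon> ^ card S"] eps
    show "eventually (\<lambda>t. \<bar>\<Prod>r\<in>R t. x - r\<bar> < \<epsilon> ^ card S) F" by simp
  qed
  let ?s = "sorted_list_of_set S"
  from R ev show "eventually (\<lambda>t. dist (sorted_list_of_set (R t) ! j) (?s ! j) < e) F"
  proof eventually_elim
    case (elim t)
    have "\<exists>r\<in>R t. \<bar>x - r\<bar> < \<epsilon>" if "x \<in> S" for x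
    proof (rule ccontr)
      assume "\<not> ?thesis"
      then have "\<epsilon> ^ card (R t) \<le> (\<Prod>r\<in>R t. \<bar>x - r\<bar>)"
        using eps prod_mono[of "R t" "\<lambda>_. \<epsilon>" "\<lambda>r. \<bar>x - r\<bar>"] by (auto simp: not_less)
      then show False using elim that by (auto simp: abs_prod)
    qed
    then obtain \<rho> where \<rho>: "\<And>x. x \<in> S \<Longrightarrow> \<rho> x \<in> R t" "\<And>x. x \<in> S \<Longrightarrow> \<bar>x - \<rho> x\<bar> < \<epsilon>"
      by metis
    have mono: "\<rho> x < \<rho> y" if "x \<in> S" "y \<in> S" "x < y" for x y
      using \<rho>(2)[OF that(1)] \<rho>(2)[OF that(2)] d(2)[OF that] eps by linarith
    have "sorted_wrt (<) ?s" by simp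
    then have "sorted_wrt (<) (map \<rho> ?s)"
      unfolding sorted_wrt_map by (rule sorted_wrt_mono_rel[rotated]) (use S mono in auto)
    moreover have "set (map \<rho> ?s) = R t"
    proof (rule card_subset_eq)
      show "set (map \<rho> ?s) \<subseteq> R t" using \<rho> S by auto
      have "inj_on \<rho> S" by (rule inj_onI) (metis mono less_irrefl linorder_neqE)
      then show "card (set (map \<rho> ?s)) = card (R t)" using S elim by (simp add: card_image)
    qed (use elim in auto)
    ultimately have "sorted_list_of_set (R t) = map \<rho> ?s"
      using elim by (intro strict_sorted_equal) auto
    moreover have "?s ! j \<in> S" using j S nth_mem[of j ?s] by simp
    ultimately show ?case using \<rho>(2)[of "?s ! j"] j eps by (simp add: dist_real_def abs_minus_commute)
  qed
qed

section \<open>First-order perturbation\<close>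

lemma tendsto_jacobi_sol:
  fixes a b :: "'b \<Rightarrow> nat \<Rightarrow> real"
  assumes "\<And>k. ((\<lambda>t. a t k) \<longlongrightarrow> a0 k) F" and "\<And>k. ((\<lambda>t. b t k) \<longlongrightarrow> b0 k) F"
    and "(l \<longlongrightarrow> l0) F" and "\<And>k. a0 k \<noteq> 0"
  shows "((\<lambda>t. jacobi_sol (a t) (b t) (l t) u v k) \<longlongrightarrow> jacobi_sol a0 b0 l0 u v k) F"
proof -
  have "((\<lambda>t. jacobi_sol (a t) (b t) (l t) u v k) \<longlongrightarrow> jacobi_sol a0 b0 l0 u v k) F \<and>
        ((\<lambda>t. jacobi_sol (a t) (b t) (l t) u v (Suc k)) \<longlongrightarrow> jacobi_sol a0 b0 l0 u v (Suc k)) F"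
    by (induction k) (auto intro!: tendsto_intros assms)
  then show ?thesis ..
qed

lemma jacobi_sol_differentiable:
  fixes a b :: "real \<Rightarrow> nat \<Rightarrow> real"
  assumes a: "\<And>k. (\<lambda>t. a t k) differentiable (at t0)"
    and b: "\<And>k. (\<lambda>t. b t k) differentiable (at t0)"
    and l: "l differentiable (at t0)" and nz: "\<And>k. a t0 k \<noteq> 0"
  shows "(\<lambda>t. jacobi_sol (a t) (b t) (l t) u v k) differentiable (at t0)"
proof -
  have "(\<lambda>t. jacobi_sol (a t) (b t) (l t) u v k) differentiable (at t0) \<and>
        (\<lambda>t. jacobi_sol (a t) (b t) (l t) u v (Suc k)) differentiable (at t0)"
    by (induction k) (auto intro!: differentiable_diff differentiable_mult differentiable_divide a b l nz)
  then show ?thesis ..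
qed

text \<open>
  The bilinear form \<open>\<Sum>\<^sub>k u\<^sub>k (dJ y)\<^sub>k\<close> over the sites \<open>1, \<dots>, n\<close>, where \<open>dJ\<close> is the Jacobi operator with
  the varied coefficients \<open>da\<close> and \<open>db\<close>.
\<close>

definition first_variation ::
  "nat \<Rightarrow> (nat \<Rightarrow> real) \<Rightarrow> (nat \<Rightarrow> real) \<Rightarrow> (nat \<Rightarrow> real) \<Rightarrow> (nat \<Rightarrow> real) \<Rightarrow> real" where
  "first_variation n da db u y =
     (\<Sum>k<n. u (Suc k) *
        (da k * y k + db (Suc k) * y (Suc k) + da (Suc k) * y (Suc (Suc k))))"

lemma first_variation_scaleR:
  "first_variation n da db (\<lambda>k. c * u k) y = c * first_variation n da db u y"
  by (simp add: first_variation_def sum_distrib_left mult.assoc)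

text \<open>
  The Hellmann-Feynman formula along a curve of coefficients. Let \<open>y\<close> and \<open>Y t\<close> be the Dirichlet
  eigenvectors at times \<open>0\<close> and \<open>t\<close>. Regarded as an approximate solution of the recurrence at
  time \<open>0\<close>, the vector \<open>Y t\<close> has the increments of the coefficients as its defect, so that Green's
  formula gives the exact identity
  \<open>(l t - l 0) * \<Sum>y\<^sub>k Y\<^sub>k(t) = \<Sum>y\<^sub>k ((J\<^sub>t - J\<^sub>0) Y(t))\<^sub>k\<close>. Dividing by \<open>t\<close> and letting \<open>t\<close> tend to \<open>0\<close>
  needs only continuity of \<open>l\<close> and proves differentiability at the same time.
\<close>

lemma eigenvalue_derivative:
  fixes a b :: "real \<Rightarrow> nat \<Rightarrow> real" and l :: "real \<Rightarrow> real"
  assumes a: "\<And>k. ((\<lambda>t. a t k) has_real_derivative da k) (at 0)"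
    and b: "\<And>k. ((\<lambda>t. b t k) has_real_derivative db k) (at 0)"
    and nz: "\<And>t k. a t k \<noteq> 0"
    and l: "isCont l 0"
    and zero: "\<And>t. jacobi_sol (a t) (b t) (l t) 0 1 (Suc n) = 0"
  defines "y \<equiv> jacobi_sol (a 0) (b 0) (l 0) 0 1"
  shows "(l has_real_derivative
     first_variation (Suc n) da db y y / (\<Sum>k<Suc n. y (Suc k) * y (Suc k))) (at 0)"
proof -
  define Y where "Y t = jacobi_sol (a t) (b t) (l t) 0 1" for t
  define S where "S t = (\<Sum>k<Suc n. y (Suc k) * Y t (Suc k))" for t
  define V where "V t = first_variation (Suc n) (\<lambda>k. (a t k - a 0 k) / t)
    (\<lambda>k. (b t k - b 0 k) / t) y (Y t)" for t
  have y: "jacobi_eq (a 0) (b 0) (l 0) (\<lambda>_. 0) y"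
    unfolding y_def by (rule jacobi_sol_eq) (rule nz)
  have Y: "jacobi_eq (a t) (b t) (l t) (\<lambda>_. 0) (Y t)" for t
    unfolding Y_def by (rule jacobi_sol_eq) (rule nz)
  have quot: "(l t - l 0) / t = V t / S t" if t: "t \<noteq> 0" and S: "S t \<noteq> 0" for t
  proof -
    \<comment> \<open>The defect of \<open>Y t\<close> in the recurrence at time \<open>0\<close>.\<close>
    define h where "h k = - ((a t (k - 1) - a 0 (k - 1)) * Y t (k - 1)
      + (b t k - b 0 k) * Y t k + (a t k - a 0 k) * Y t (Suc k))" for k
    have "jacobi_eq (a 0) (b 0) (l t) h (Y t)"
      using Y[of t] by (simp add: jacobi_eq_def h_def algebra_simps)
    from green[OF y this, of "Suc n"]
    have "(\<Sum>k<Suc n. y (Suc k) * ((l t - l 0) * Y t (Suc k) + h (Suc k))) = 0"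
      using zero[of t] zero[of 0] by (simp add: wronskian_def y_def Y_def)
    moreover have "(\<Sum>k<Suc n. y (Suc k) * ((l t - l 0) * Y t (Suc k) + h (Suc k)))
        = (l t - l 0) * S t - t * V t"
      using t unfolding S_def V_def first_variation_def sum_distrib_left sum_subtractf[symmetric]
      by (intro sum.cong) (simp_all add: h_def field_simps)
    ultimately show ?thesis using t S by (simp add: field_simps)
  qed
  have lim: "((\<lambda>t. a t k) \<longlongrightarrow> a 0 k) (at 0)" "((\<lambda>t. b t k) \<longlongrightarrow> b 0 k) (at 0)" for k
    using DERIV_isCont[OF a] DERIV_isCont[OF b] by (auto simp: isCont_def)
  have Ylim: "((\<lambda>t. Y t k) \<longlongrightarrow> y k) (at 0)" for k
    unfolding Y_def y_def by (rule tendsto_jacobi_sol) (use lim l nz in \<open>auto simp: isCont_def\<close>)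
  have Slim: "(S \<longlongrightarrow> (\<Sum>k<Suc n. y (Suc k) * y (Suc k))) (at 0)"
    unfolding S_def by (intro tendsto_intros Ylim)
  have "(V \<longlongrightarrow> first_variation (Suc n) da db y y) (at 0)"
    unfolding V_def first_variation_def using a b
    by (intro tendsto_intros Ylim) (auto simp: DERIV_def)
  moreover have pos: "(\<Sum>k<Suc n. y (Suc k) * y (Suc k)) > 0"
    by (rule sum_squares_pos) (simp add: y_def)
  ultimately have "((\<lambda>t. V t / S t) \<longlongrightarrow>
      first_variation (Suc n) da db y y / (\<Sum>k<Suc n. y (Suc k) * y (Suc k))) (at 0)"
    by (intro tendsto_divide Slim) auto
  moreover have "eventually (\<lambda>t. S t > 0) (at 0)"
    using order_tendstoD(1)[OF Slim pos] .
  then have "eventually (\<lambda>t. V t / S t = (l (0 + t) - l 0) / t) (at 0)"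
    using eventually_neq_at_within[of 0 0 UNIV] by eventually_elim (auto simp: quot)
  ultimately show ?thesis unfolding DERIV_def by (rule Lim_transform_eventually)
qed

text \<open>
  The derivative \<open>z\<close> of the eigenvector along the curve solves the linearized recurrence and
  vanishes at the sites \<open>0\<close>, \<open>1\<close> and \<open>Suc n\<close>. Hence Green's formula with a second solution \<open>\<theta>\<close> contains
  \<open>z\<close> only through its value one site beyond the right end, which is the wanted derivative. The term
  with the derivative of the eigenvalue drops out because \<open>\<theta>\<close> is orthogonal to the eigenvector, and the
  Wronskian \<open>- 1\<close>, evaluated at the right end, turns the factor \<open>a\<^sub>N \<theta>\<^sub>N\<close> into \<open>- 1 / y\<^sub>N\<^sub>+\<^sub>1\<close>, which makes
  the derivative logarithmic.
\<close>

lemma norming_derivative: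
  fixes a b :: "real \<Rightarrow> nat \<Rightarrow> real" and l :: "real \<Rightarrow> real"
  assumes a: "\<And>k. ((\<lambda>t. a t k) has_real_derivative da k) (at 0)"
    and b: "\<And>k. ((\<lambda>t. b t k) has_real_derivative db k) (at 0)"
    and nz: "\<And>t k. a t k \<noteq> 0"
    and l: "(l has_real_derivative dl) (at 0)"
    and zero: "\<And>t. jacobi_sol (a t) (b t) (l t) 0 1 (Suc n) = 0"
  defines "y \<equiv> jacobi_sol (a 0) (b 0) (l 0) 0 1"
  assumes \<theta>: "jacobi_eq (a 0) (b 0) (l 0) (\<lambda>_. 0) \<theta>"
    and orth: "(\<Sum>k<Suc n. \<theta> (Suc k) * y (Suc k)) = 0"
    and W: "wronskian (a 0) \<theta> y 0 = - 1"
    and c: "c \<noteq> 0"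
  shows "((\<lambda>t. ln (c * jacobi_sol (a t) (b t) (l t) 0 1 (Suc (Suc n)))) has_real_derivative
     first_variation (Suc n) da db \<theta> y) (at 0)"
proof -
  define Y where "Y t = jacobi_sol (a t) (b t) (l t) 0 1" for t
  define z where "z k = deriv (\<lambda>t. Y t k) 0" for k
  have y: "jacobi_eq (a 0) (b 0) (l 0) (\<lambda>_. 0) y"
    unfolding y_def by (rule jacobi_sol_eq) (rule nz)
  have Y: "jacobi_eq (a t) (b t) (l t) (\<lambda>_. 0) (Y t)" for t
    unfolding Y_def by (rule jacobi_sol_eq) (rule nz)
  have Y0: "Y 0 = y" by (simp add: Y_def y_def)
  have z: "((\<lambda>t. Y t k) has_real_derivative z k) (at 0)" for k
  proof -
    have "(\<lambda>t. Y t k) differentiable (at 0)"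
      unfolding Y_def using a b l nz
      by (intro jacobi_sol_differentiable) (auto simp: real_differentiable_def)
    then show ?thesis unfolding z_def
      by (auto simp: real_differentiable_def dest: DERIV_imp_deriv)
  qed
  have z_const: "z k = 0" if "\<And>t. Y t k = x" for k x
    using z[of k] that by (auto intro: DERIV_unique[OF _ DERIV_const])
  \<comment> \<open>The inhomogeneity of the linearized recurrence.\<close>
  define h where "h k = dl * y k - (da (k - 1) * y (k - 1) + db k * y k + da k * y (Suc k))" for k
  have "jacobi_eq (a 0) (b 0) (l 0) h z"
    unfolding jacobi_eq_def
  proof
    fix k
    have "((\<lambda>t. a t k * Y t k + b t (Suc k) * Y t (Suc k) + a t (Suc k) * Y t (Suc (Suc k)))
        has_real_derivative da k * y k + a 0 k * z k + (db (Suc k) * y (Suc k) + b 0 (Suc k) * z (Suc k))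
          + (da (Suc k) * y (Suc (Suc k)) + a 0 (Suc k) * z (Suc (Suc k)))) (at 0)"
      by (auto intro!: derivative_eq_intros a b z simp: Y0)
    then have "((\<lambda>t. l t * Y t (Suc k)) has_real_derivative
        da k * y k + a 0 k * z k + (db (Suc k) * y (Suc k) + b 0 (Suc k) * z (Suc k))
          + (da (Suc k) * y (Suc (Suc k)) + a 0 (Suc k) * z (Suc (Suc k)))) (at 0)"
      using Y by (simp add: jacobi_eq_def)
    moreover have "((\<lambda>t. l t * Y t (Suc k)) has_real_derivative
        dl * y (Suc k) + l 0 * z (Suc k)) (at 0)"
      by (auto intro!: derivative_eq_intros l z simp: Y0)
    ultimately have "da k * y k + a 0 k * z k + (db (Suc k) * y (Suc k) + b 0 (Suc k) * z (Suc k))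
          + (da (Suc k) * y (Suc (Suc k)) + a 0 (Suc k) * z (Suc (Suc k)))
        = dl * y (Suc k) + l 0 * z (Suc k)"
      by (rule DERIV_unique)
    then show "a 0 k * z k + b 0 (Suc k) * z (Suc k) + a 0 (Suc k) * z (Suc (Suc k))
        = l 0 * z (Suc k) + h (Suc k)"
      by (simp add: h_def)
  qed
  from green[OF \<theta> this, of "Suc n"]
  have "a 0 (Suc n) * \<theta> (Suc n) * z (Suc (Suc n)) = (\<Sum>k<Suc n. \<theta> (Suc k) * h (Suc k))"
    using z_const[of 0 0] z_const[of 1 1] z_const[of "Suc n" 0] zero
    by (simp add: wronskian_def Y_def)
  also have "\<dots> = dl * (\<Sum>k<Suc n. \<theta> (Suc k) * y (Suc k)) - first_variation (Suc n) da db \<theta> y"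
    unfolding first_variation_def sum_distrib_left sum_subtractf[symmetric]
    by (intro sum.cong) (simp_all add: h_def algebra_simps)
  finally have dz: "a 0 (Suc n) * \<theta> (Suc n) * z (Suc (Suc n)) = - first_variation (Suc n) da db \<theta> y"
    using orth by simp
  have "wronskian (a 0) \<theta> y (Suc n) = - 1"
    using wronskian_constant[OF \<theta> y] W by simp
  then have W': "a 0 (Suc n) * \<theta> (Suc n) * y (Suc (Suc n)) = - 1"
    using zero[of 0] by (simp add: wronskian_def y_def)
  then have nz': "y (Suc (Suc n)) \<noteq> 0" by auto
  have "z (Suc (Suc n)) = first_variation (Suc n) da db \<theta> y * y (Suc (Suc n))"
    using W' dz by algebra
  then have eq: "first_variation (Suc n) da db \<theta> y = z (Suc (Suc n)) / y (Suc (Suc n))"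
    using nz' by simp
  \<comment> \<open>Passing to the square makes the argument of the logarithm positive, whatever the sign of
    \<open>c * y (Suc (Suc n))\<close>: the real logarithm is taken of the absolute value.\<close>
  have "ln (c * Y t (Suc (Suc n))) = ln ((c * Y t (Suc (Suc n)))\<^sup>2) / 2" for t
    by (simp add: ln_realpow)
  moreover have "((\<lambda>t. ln ((c * Y t (Suc (Suc n)))\<^sup>2) / 2) has_real_derivative
      first_variation (Suc n) da db \<theta> y) (at 0)"
    unfolding eq using c nz'
    by (auto intro!: derivative_eq_intros z simp: Y0 field_simps power2_eq_square
        zero_less_mult_iff not_less_iff_gr_or_eq)
  ultimately show ?thesis by (simp only: Y_def)
qed

section \<open>Products of solutions and their bracket\<close>

text \<open>
  For two solutions \<open>u, v\<close> at the same spectral parameter, the pair \<open>prod_a a u v, prod_b u v\<close> is the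
  gradient of \<open>\<Sum> u\<^sub>k (J v)\<^sub>k\<close> with respect to the logarithms of the \<open>a\<^sub>k\<close> and the \<open>b\<^sub>k\<close>, provided that
  \<open>v\<close> vanishes at both ends. For \<open>u = v\<close> the second component consists of the squared eigenfunctions.
\<close>

definition prod_a :: "(nat \<Rightarrow> real) \<Rightarrow> (nat \<Rightarrow> real) \<Rightarrow> (nat \<Rightarrow> real) \<Rightarrow> nat \<Rightarrow> real" where
  "prod_a a u v k = a k * (u k * v (Suc k) + u (Suc k) * v k)"

definition prod_b :: "(nat \<Rightarrow> real) \<Rightarrow> (nat \<Rightarrow> real) \<Rightarrow> nat \<Rightarrow> real" where
  "prod_b u v k = u k * v k"

text \<open>
  The form \<open>\<wedge>\<close> for sequences on \<open>0, \<dots>, n\<close> in place of periodic vectors; here \<open>A 0\<close> and \<open>A n\<close> are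
  independent of each other.
\<close>

definition bracket ::
  "nat \<Rightarrow> (nat \<Rightarrow> real) \<Rightarrow> (nat \<Rightarrow> real) \<Rightarrow> (nat \<Rightarrow> real) \<Rightarrow> (nat \<Rightarrow> real) \<Rightarrow> real" where
  "bracket n A B C D =
     (\<Sum>k<n. (A (Suc k) - A k) * D (Suc k) - B (Suc k) * (C (Suc k) - C k))"

text \<open>
  Summation by parts collects the coefficient of each \<open>x k\<close>. The boundary terms carry the factors
  \<open>y 0\<close> and \<open>y n\<close>.
\<close>

lemma first_variation_eq_prod:
  assumes "y 0 = 0" and "y n = 0"
  shows "first_variation n (\<lambda>k. a k * x k) b u y
           = (\<Sum>k<n. prod_a a u y (Suc k) * x (Suc k) + prod_b u y (Suc k) * b (Suc k))"
proof -
  have "first_variation m (\<lambda>k. a k * x k) b u y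
      = (\<Sum>k<m. prod_a a u y (Suc k) * x (Suc k) + prod_b u y (Suc k) * b (Suc k))
        + u 1 * (a 0 * x 0) * y 0 - u (Suc m) * (a m * x m) * y m" for m
    by (induction m) (simp_all add: first_variation_def prod_a_def prod_b_def algebra_simps)
  from this[of n] show ?thesis using assms by simp
qed

text \<open>
  Products of solutions satisfy a linear recurrence of their own, the discrete counterpart of the
  third-order equation for squared eigenfunctions.
\<close>

lemma prod_a_step:
  assumes "jacobi_eq a b l (\<lambda>_. 0) u" and "jacobi_eq a b l (\<lambda>_. 0) v"
  shows "prod_a a u v (Suc k)
           = 2 * (l - b (Suc k)) * prod_b u v (Suc k) - prod_a a u v k"
proof -
  have u: "a (Suc k) * u (Suc (Suc k)) = l * u (Suc k) - a k * u k - b (Suc k) * u (Suc k)"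
    and v: "a (Suc k) * v (Suc (Suc k)) = l * v (Suc k) - a k * v k - b (Suc k) * v (Suc k)"
    using assms by (simp_all add: jacobi_eq_def eq_diff_eq ac_simps)
  have "prod_a a u v (Suc k)
      = u (Suc k) * (a (Suc k) * v (Suc (Suc k))) + a (Suc k) * u (Suc (Suc k)) * v (Suc k)"
    by (simp add: prod_a_def algebra_simps)
  then show ?thesis unfolding u v by (simp add: prod_a_def prod_b_def algebra_simps)
qed

text \<open>
  The reason behind all vanishing brackets: for products of solutions at different spectral
  parameters the summand of the bracket is the increment of a symmetric combination of Wronskians,
  divided by the difference of the parameters. So the bracket is determined by boundary values.
\<close>

lemma bracket_products:
  assumes u: "jacobi_eq a b l (\<lambda>_. 0) u" and v: "jacobi_eq a b l (\<lambda>_. 0) v"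
    and w: "jacobi_eq a b m (\<lambda>_. 0) w" and z: "jacobi_eq a b m (\<lambda>_. 0) z"
  defines "E \<equiv> \<lambda>k. wronskian a u w k * wronskian a v z k + wronskian a u z k * wronskian a v w k"
  shows "(l - m) * bracket n (prod_a a u v) (prod_b u v) (prod_a a w z) (prod_b w z) = E n - E 0"
proof -
  have "(l - m) * ((prod_a a u v (Suc k) - prod_a a u v k) * prod_b w z (Suc k)
        - prod_b u v (Suc k) * (prod_a a w z (Suc k) - prod_a a w z k)) = E (Suc k) - E k" for k
  proof -
    have W: "wronskian a f g (Suc k) = wronskian a f g k + (m - l) * f (Suc k) * g (Suc k)"
      if "jacobi_eq a b l (\<lambda>_. 0) f" "jacobi_eq a b m (\<lambda>_. 0) g" for f g
      using wronskian_step[OF that, of k] by (simp add: algebra_simps)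
    show ?thesis
      unfolding E_def prod_a_step[OF u v] prod_a_step[OF w z]
        W[OF u w] W[OF v z] W[OF u z] W[OF v w]
      by (simp add: prod_a_def prod_b_def wronskian_def algebra_simps)
  qed
  then have "(l - m) * bracket n (prod_a a u v) (prod_b u v) (prod_a a w z) (prod_b w z)
      = (\<Sum>k<n. E (Suc k) - E k)"
    unfolding bracket_def sum_distrib_left by (intro sum.cong refl)
  then show ?thesis by (simp only: sum_lessThan_telescope)
qed

text \<open>
  At coinciding spectral parameters the summand is a multiple of \<open>v\<^sub>k\<^sup>2\<close> by the Wronskian, which does
  not depend on the site.
\<close>

lemma bracket_products_same:
  assumes u: "jacobi_eq a b l (\<lambda>_. 0) u" and v: "jacobi_eq a b l (\<lambda>_. 0) v"
  shows "bracket n (prod_a a u v) (prod_b u v) (prod_a a v v) (prod_b v v)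
           = - 2 * wronskian a u v 0 * (\<Sum>k<n. v (Suc k) * v (Suc k))"
proof -
  have "(prod_a a u v (Suc k) - prod_a a u v k) * prod_b v v (Suc k)
        - prod_b u v (Suc k) * (prod_a a v v (Suc k) - prod_a a v v k)
      = - 2 * wronskian a u v 0 * (v (Suc k) * v (Suc k))" for k
    unfolding prod_a_step[OF u v] prod_a_step[OF v v] wronskian_constant[OF u v, of k, symmetric]
    by (simp add: prod_a_def prod_b_def wronskian_def algebra_simps)
  then show ?thesis
    unfolding bracket_def sum_distrib_left by (intro sum.cong refl)
qed

lemma bracket_products_same_scaled:
  assumes u: "jacobi_eq a b l (\<lambda>_. 0) u" and v: "jacobi_eq a b l (\<lambda>_. 0) v"
  shows "bracket n (prod_a a u v) (prod_b u v) (prod_a a (\<lambda>k. c * v k) v) (prod_b (\<lambda>k. c * v k) v)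
           = - 2 * wronskian a u v 0 * (c * (\<Sum>k<n. v (Suc k) * v (Suc k)))"
proof -
  have "bracket n (prod_a a u v) (prod_b u v) (prod_a a (\<lambda>k. c * v k) v) (prod_b (\<lambda>k. c * v k) v)
      = c * bracket n (prod_a a u v) (prod_b u v) (prod_a a v v) (prod_b v v)"
    by (simp add: bracket_def prod_a_def prod_b_def sum_distrib_left algebra_simps)
  then show ?thesis by (simp add: bracket_products_same[OF u v])
qed

section \<open>Gradients on the phase space\<close>

lemma sum_site: "(\<Sum>i\<in>UNIV. f i) = (\<Sum>k<CARD('n). f (site (int (Suc k))))"
  for f :: "'n::{finite,linorder} \<Rightarrow> real"
proof -
  have "(\<Sum>i\<in>UNIV. f i) = (\<Sum>i\<in>{1..int CARD('n)}. f (site i))"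
    by (rule sum.reindex_bij_betw[OF bij_betw_site, symmetric])
  also have "\<dots> = (\<Sum>k<CARD('n). f (site (int (Suc k))))"
    by (rule sum.reindex_bij_witness[of _ "\<lambda>k. int (Suc k)" "\<lambda>i. nat (i - 1)"]) auto
  finally show ?thesis .
qed

text \<open>
  The vector with the entries \<open>A 1, \<dots>, A N\<close>, projected orthogonally to the space of vectors with
  vanishing sum by subtracting the mean.
\<close>

definition site_vec :: "(nat \<Rightarrow> real) \<Rightarrow> real^'n::{finite,linorder}" where
  "site_vec A = (\<chi> i. A (nat (inv_into {1..int CARD('n)} site i))
     - (\<Sum>k<CARD('n). A (Suc k)) / real CARD('n))"

lemma site_vec_nth:
  assumes "k < CARD('n)"
  shows "(site_vec A :: real^'n::{finite,linorder}) $ site (int (Suc k))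
    = A (Suc k) - (\<Sum>k<CARD('n). A (Suc k)) / real CARD('n)"
proof -
  have "inj_on (site :: int \<Rightarrow> 'n) {1..int CARD('n)}"
    using bij_betw_site by (rule bij_betw_imp_inj_on)
  then have "inv_into {1..int CARD('n)} (site :: int \<Rightarrow> 'n) (site (int (Suc k))) = int (Suc k)"
    by (rule inv_into_f_f) (use assms in auto)
  then show ?thesis by (simp add: site_vec_def del: of_nat_Suc)
qed

lemma site_vec_nth_periodic:
  assumes "k \<le> CARD('n)" and "A 0 = A CARD('n)"
  shows "(site_vec A :: real^'n::{finite,linorder}) $ site (int k)
    = A k - (\<Sum>k<CARD('n). A (Suc k)) / real CARD('n)"
proof (cases k)
  case 0
  have "(site 0 :: 'n) = site (int CARD('n))" using site_periodic[of 0, where 'n='n] by simp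
  moreover have "CARD('n) = Suc (CARD('n) - 1)" by simp
  ultimately show ?thesis
    using site_vec_nth[of "CARD('n) - 1" A, where 'n='n] 0 assms(2) by simp
next
  case (Suc j)
  then show ?thesis using assms(1) site_vec_nth[of j A, where 'n='n] by simp
qed

lemma site_vec_H: "site_vec A \<in> (H :: (real^'n::{finite,linorder}) set)"
proof -
  have "(\<Sum>i\<in>UNIV. (site_vec A :: (real, 'n) vec) $ i)
      = (\<Sum>k<CARD('n). A (Suc k) - (\<Sum>k<CARD('n). A (Suc k)) / real CARD('n))"
    unfolding sum_site by (intro sum.cong refl site_vec_nth) simp
  then show ?thesis by (simp add: H_def sum_subtractf)
qed

text \<open>
  The projection is invisible to vectors that are already in \<open>H\<close>.
\<close>

lemma inner_site_vec:
  fixes v :: "real^'n::{finite,linorder}"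
  assumes "v \<in> H"
  shows "site_vec A \<bullet> v = (\<Sum>k<CARD('n). A (Suc k) * v $ site (int (Suc k)))"
proof -
  define \<mu> where "\<mu> = (\<Sum>k<CARD('n). A (Suc k)) / real CARD('n)"
  have "site_vec A \<bullet> v = (\<Sum>k<CARD('n). (A (Suc k) - \<mu>) * v $ site (int (Suc k)))"
    unfolding inner_vec_def inner_real_def sum_site \<mu>_def
    by (intro sum.cong refl) (simp add: site_vec_nth del: of_nat_Suc)
  also have "\<dots> = (\<Sum>k<CARD('n). A (Suc k) * v $ site (int (Suc k)))
      - \<mu> * (\<Sum>k<CARD('n). v $ site (int (Suc k)))"
    by (simp add: left_diff_distrib sum_subtractf sum_distrib_left)
  also have "(\<Sum>k<CARD('n). v $ site (int (Suc k))) = 0"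
    using assms sum_site[of "\<lambda>i. v $ i"] by (simp add: H_def)
  finally show ?thesis by simp
qed

lemma grad_eq_site_vec:
  fixes f :: "'n::{finite,linorder} phase \<Rightarrow> real"
  assumes "\<And>v. ((\<lambda>t. f (q + t *\<^sub>R v)) has_real_derivative
     (\<Sum>k<CARD('n). A (Suc k) * fst v $ site (int (Suc k))
        + B (Suc k) * snd v $ site (int (Suc k)))) (at 0)"
  shows "grad f q = (site_vec A, site_vec B)"
proof (rule grad_eqI, unfold is_grad_def, intro conjI ballI)
  show "(site_vec A, site_vec B) \<in> (H2 :: 'n phase set)"
    by (simp add: H2_def site_vec_H)
  fix v :: "'n phase" assume "v \<in> H2"
  then have "fst v \<in> H" "snd v \<in> H" by (auto simp: H2_def)
  then have "(site_vec A, site_vec B) \<bullet> v = (\<Sum>k<CARD('n). A (Suc k) * fst v $ site (int (Suc k))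
        + B (Suc k) * snd v $ site (int (Suc k)))"
    by (simp add: inner_prod_def inner_site_vec sum.distrib)
  with assms[of v] show "((\<lambda>t. f (q + t *\<^sub>R v)) has_real_derivative
      (site_vec A, site_vec B) \<bullet> v) (at 0)" by simp
qed

text \<open>
  The form does not see the means that were subtracted: it pairs the constant vectors with the sums of
  \<open>A (Suc k) - A k\<close> and \<open>C (Suc k) - C k\<close> over one period, which telescope to \<open>0\<close>.
\<close>

lemma wedge_site_vec:
  assumes A: "A 0 = A CARD('n)" and C: "C 0 = C CARD('n)"
  shows "wedge (site_vec A, site_vec B) (site_vec C, site_vec D :: real^'n::{finite,linorder})
           = bracket CARD('n) A B C D"
proof -
  define \<mu> where "\<mu> E = (\<Sum>k<CARD('n). E (Suc k)) / real CARD('n)" for E :: "nat \<Rightarrow> real"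
  have *: "(site_vec E :: (real, 'n) vec) $ site (int (Suc k)) = E (Suc k) - \<mu> E" if "k < CARD('n)" for k E
    unfolding \<mu>_def by (rule site_vec_nth[OF that])
  have **: "(site_vec E :: (real, 'n) vec) $ site (int k) = E k - \<mu> E"
    if "k < CARD('n)" "E 0 = E CARD('n)" for k E
    unfolding \<mu>_def by (rule site_vec_nth_periodic) (use that in auto)
  let ?f = "(site_vec A, site_vec B) :: 'n phase" and ?g = "(site_vec C, site_vec D) :: 'n phase"
  have "wedge ?f ?g = (\<Sum>k<CARD('n).
      (fst ?f $ site (int (Suc k)) * snd ?g $ site (int (Suc k))
        - snd ?f $ site (int (Suc k)) * fst ?g $ site (int (Suc k)))
    - (fst ?f $ site (int k) * snd ?g $ site (int (Suc k))
        - snd ?f $ site (int (Suc k)) * fst ?g $ site (int k)))"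
    unfolding wedge_def
    by (rule sum.reindex_bij_witness[of _ "\<lambda>k. int (Suc k)" "\<lambda>i. nat (i - 1)"]) auto
  also have "\<dots> = (\<Sum>k<CARD('n). ((A (Suc k) - A k) * D (Suc k) - B (Suc k) * (C (Suc k) - C k))
      - \<mu> D * (A (Suc k) - A k) + \<mu> B * (C (Suc k) - C k))"
    by (intro sum.cong refl) (simp add: * ** A C algebra_simps del: of_nat_Suc)
  also have "\<dots> = bracket CARD('n) A B C D
      - \<mu> D * (\<Sum>k<CARD('n). A (Suc k) - A k) + \<mu> B * (\<Sum>k<CARD('n). C (Suc k) - C k)"
    unfolding bracket_def sum_distrib_left sum_subtractf[symmetric] sum.distrib[symmetric] ..
  also have "\<dots> = bracket CARD('n) A B C D"
    by (simp only: sum_lessThan_telescope A C) simp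
  finally show ?thesis .
qed

section \<open>Gradients of the eigenvalues and norming constants\<close>

definition a_seq :: "'n::{finite,linorder} phase \<Rightarrow> nat \<Rightarrow> real" where
  "a_seq q k = acoef q (int k)"

definition b_seq :: "'n::{finite,linorder} phase \<Rightarrow> nat \<Rightarrow> real" where
  "b_seq q k = bcoef q (int k)"

lemma a_seq_nz: "a_seq q k \<noteq> 0"
  by (simp add: a_seq_def acoef_def)

lemma phi_eq_jacobi_sol:
  "phi q l (int k)
     = jacobi_sol (\<lambda>k. of_real (a_seq q k)) (\<lambda>k. of_real (b_seq q k)) l 0 1 k"
proof (induction k rule: less_induct)
  case (less k)
  have phi: "phi q l 0 = 0" "phi q l 1 = 1"
    "of_real (acoef q (i - 1)) * phi q l (i - 1) + of_real (bcoef q i) * phi q l i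
       + of_real (acoef q i) * phi q l (i + 1) = l * phi q l i" for i
    using is_phi_phi[of q l] by (simp_all add: is_phi_def)
  consider "k = 0" | "k = 1" | j where "k = Suc (Suc j)"
    by (metis One_nat_def not0_implies_Suc)
  then show ?case
  proof cases
    case (3 j)
    have "of_real (a_seq q j) * phi q l (int j) + of_real (b_seq q (Suc j)) * phi q l (int (Suc j))
       + of_real (a_seq q (Suc j)) * phi q l (int k) = l * phi q l (int (Suc j))"
      using phi(3)[of "int (Suc j)"] by (simp add: a_seq_def b_seq_def 3 ac_simps)
    then have "phi q l (int k) = ((l - of_real (b_seq q (Suc j))) * phi q l (int (Suc j))
       - of_real (a_seq q j) * phi q l (int j)) / of_real (a_seq q (Suc j))"
      using a_seq_nz[of q "Suc j"] by (simp add: field_simps)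
    then show ?thesis using less[of j] less[of "Suc j"] by (simp add: 3)
  qed (use phi in simp_all)
qed

lemma phi_of_real:
  "phi q (of_real l) (int k) = of_real (jacobi_sol (a_seq q) (b_seq q) l 0 1 k)"
  using jacobi_sol_of_real[of "a_seq q" "b_seq q" l 0 1 k, where 'a=complex]
  by (simp add: phi_eq_jacobi_sol)

definition dirichlet_set :: "'n::{finite,linorder} phase \<Rightarrow> real set" where
  "dirichlet_set q = {l. jacobi_sol (a_seq q) (b_seq q) l 0 1 CARD('n) = 0}"

lemma nu_eq: "nu i q = sorted_list_of_set (dirichlet_set q) ! (i - 1)"
  by (simp add: nu_def dirichlet_set_def phi_of_real)

lemma psi1_eq:
  "psi1 i q = ln ((-1) ^ (CARD('n) - i)
     * jacobi_sol (a_seq q) (b_seq q) (nu i q) 0 1 (Suc CARD('n)))"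
  for q :: "'n::{finite,linorder} phase"
proof -
  have "int CARD('n) + 1 = int (Suc CARD('n))" by simp
  then show ?thesis unfolding psi1_def by (simp only: phi_of_real Re_complex_of_real)
qed

lemma CARD_eq_Suc: obtains n where "CARD('n::finite) = Suc n"
  using gr0_implies_Suc[OF zero_less_card_finite[where 'a='n]] that by auto

lemma
  fixes q :: "'n::{finite,linorder} phase"
  shows finite_dirichlet_set: "finite (dirichlet_set q)"
    and card_dirichlet_set: "card (dirichlet_set q) = CARD('n) - 1"
    and prod_dirichlet_set: "(\<Prod>k<CARD('n) - 1. a_seq q (Suc k))
          * jacobi_sol (a_seq q) (b_seq q) x 0 1 CARD('n) = (\<Prod>r\<in>dirichlet_set q. x - r)"
proof -
  obtain n where n: "CARD('n) = Suc n" by (rule CARD_eq_Suc)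
  show "finite (dirichlet_set q)" "card (dirichlet_set q) = CARD('n) - 1"
    "(\<Prod>k<CARD('n) - 1. a_seq q (Suc k))
          * jacobi_sol (a_seq q) (b_seq q) x 0 1 CARD('n) = (\<Prod>r\<in>dirichlet_set q. x - r)"
    using dirichlet_spectrum[of "a_seq q", OF a_seq_nz, where b="b_seq q" and n=n]
    by (simp_all add: dirichlet_set_def n del: jacobi_sol.simps)
qed

lemma nu_mem:
  fixes q :: "'n::{finite,linorder} phase"
  assumes "i \<in> {1..CARD('n) - 1}"
  shows "nu i q \<in> dirichlet_set q"
  unfolding nu_eq using assms finite_dirichlet_set[of q] card_dirichlet_set[of q]
    nth_mem[of "i - 1" "sorted_list_of_set (dirichlet_set q)"] by auto

lemma nu_root:
  fixes q :: "'n::{finite,linorder} phase"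
  assumes "i \<in> {1..CARD('n) - 1}"
  shows "jacobi_sol (a_seq q) (b_seq q) (nu i q) 0 1 CARD('n) = 0"
  using nu_mem[OF assms, of q] by (simp add: dirichlet_set_def)

lemma nu_inj:
  fixes q :: "'n::{finite,linorder} phase"
  assumes "i \<in> {1..CARD('n) - 1}" and "j \<in> {1..CARD('n) - 1}" and "i \<noteq> j"
  shows "nu i q \<noteq> nu j q"
  unfolding nu_eq using assms card_dirichlet_set[of q]
  by (subst nth_eq_iff_index_eq) auto

context
  fixes q v :: "'n::{finite,linorder} phase"
begin

lemma a_seq_deriv: "((\<lambda>t. a_seq (q + t *\<^sub>R v) k) has_real_derivative
    a_seq q k * fst v $ site (int k)) (at 0)"
  unfolding a_seq_def acoef_def by (auto intro!: derivative_eq_intros)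

lemma b_seq_deriv: "((\<lambda>t. b_seq (q + t *\<^sub>R v) k) has_real_derivative
    snd v $ site (int k)) (at 0)"
  unfolding b_seq_def bcoef_def by (auto intro!: derivative_eq_intros)

text \<open>
  For each Dirichlet eigenvalue \<open>x\<close> at \<open>q\<close>, the value of the characteristic polynomial at \<open>x\<close> tends
  to \<open>0\<close> along the line; its factorization over the eigenvalues then forces these to converge.
\<close>

lemma nu_isCont:
  assumes i: "i \<in> {1..CARD('n) - 1}"
  shows "isCont (\<lambda>t. nu i (q + t *\<^sub>R v)) 0"
proof -
  have "((\<lambda>t. sorted_list_of_set (dirichlet_set (q + t *\<^sub>R v)) ! (i - 1))
      \<longlongrightarrow> sorted_list_of_set (dirichlet_set q) ! (i - 1)) (at 0)"
  proof (rule tendsto_sorted_roots)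
    fix x assume x: "x \<in> dirichlet_set q"
    have lim: "((\<lambda>t. a_seq (q + t *\<^sub>R v) k) \<longlongrightarrow> a_seq q k) (at 0)"
      "((\<lambda>t. b_seq (q + t *\<^sub>R v) k) \<longlongrightarrow> b_seq q k) (at 0)" for k
      using DERIV_isCont[OF a_seq_deriv] DERIV_isCont[OF b_seq_deriv] by (simp_all add: isCont_def)
    have "((\<lambda>t. (\<Prod>k<CARD('n) - 1. a_seq (q + t *\<^sub>R v) (Suc k))
        * jacobi_sol (a_seq (q + t *\<^sub>R v)) (b_seq (q + t *\<^sub>R v)) x 0 1 CARD('n))
      \<longlongrightarrow> (\<Prod>k<CARD('n) - 1. a_seq q (Suc k)) * jacobi_sol (a_seq q) (b_seq q) x 0 1 CARD('n)) (at 0)"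
      by (intro tendsto_intros tendsto_jacobi_sol lim a_seq_nz)
    moreover have "jacobi_sol (a_seq q) (b_seq q) x 0 1 CARD('n) = 0"
      using x by (simp add: dirichlet_set_def)
    ultimately have "((\<lambda>t. (\<Prod>k<CARD('n) - 1. a_seq (q + t *\<^sub>R v) (Suc k))
        * jacobi_sol (a_seq (q + t *\<^sub>R v)) (b_seq (q + t *\<^sub>R v)) x 0 1 CARD('n)) \<longlongrightarrow> 0) (at 0)"
      by simp
    then show "((\<lambda>t. \<Prod>r\<in>dirichlet_set (q + t *\<^sub>R v). x - r) \<longlongrightarrow> 0) (at 0)"
      by (simp only: prod_dirichlet_set)
  qed (use i in \<open>auto simp: finite_dirichlet_set card_dirichlet_set\<close>)
  then show ?thesis by (simp add: isCont_def nu_eq)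
qed

end

definition eigenvec :: "nat \<Rightarrow> 'n::{finite,linorder} phase \<Rightarrow> nat \<Rightarrow> real" where
  "eigenvec i q = jacobi_sol (a_seq q) (b_seq q) (nu i q) 0 1"

definition norm2 :: "nat \<Rightarrow> 'n::{finite,linorder} phase \<Rightarrow> real" where
  "norm2 i q = (\<Sum>k<CARD('n). eigenvec i q (Suc k) * eigenvec i q (Suc k))"

text \<open>
  A second solution of the eigenvalue equation, conjugate to the eigenvector. Its value
  \<open>- 1 / a\<^sub>0\<close> at the site \<open>0\<close> normalizes the Wronskian to \<open>- 1\<close>; the remaining freedom of adding a
  multiple of the eigenvector is used to make the two orthogonal.
\<close>

definition conjvec :: "nat \<Rightarrow> 'n::{finite,linorder} phase \<Rightarrow> nat \<Rightarrow> real" where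
  "conjvec i q = (let \<eta> = jacobi_sol (a_seq q) (b_seq q) (nu i q) (- 1 / a_seq q 0) 0;
       c = (\<Sum>k<CARD('n). \<eta> (Suc k) * eigenvec i q (Suc k)) / norm2 i q
     in (\<lambda>k. \<eta> k - c * eigenvec i q k))"

lemma eigenvec_0: "eigenvec i q 0 = 0" and eigenvec_1: "eigenvec i q (Suc 0) = 1"
  by (simp_all add: eigenvec_def)

lemma eigenvec_CARD:
  fixes q :: "'n::{finite,linorder} phase"
  assumes "i \<in> {1..CARD('n) - 1}"
  shows "eigenvec i q CARD('n) = 0"
  unfolding eigenvec_def by (rule nu_root[OF assms])

lemma eigenvec_eq: "jacobi_eq (a_seq q) (b_seq q) (nu i q) (\<lambda>_. 0) (eigenvec i q)"
  unfolding eigenvec_def by (rule jacobi_sol_eq) (rule a_seq_nz)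

lemma norm2_pos: "norm2 i q > 0" for q :: "'n::{finite,linorder} phase"
proof -
  obtain n where n: "CARD('n) = Suc n" by (rule CARD_eq_Suc)
  show ?thesis unfolding norm2_def n by (rule sum_squares_pos) (simp add: eigenvec_1)
qed

lemma conjvec_eq: "jacobi_eq (a_seq q) (b_seq q) (nu i q) (\<lambda>_. 0) (conjvec i q)"
  unfolding conjvec_def Let_def
  by (intro jacobi_eq_diff jacobi_eq_scale eigenvec_eq jacobi_sol_eq a_seq_nz)

lemma conjvec_orth: "(\<Sum>k<CARD('n). conjvec i q (Suc k) * eigenvec i q (Suc k)) = 0"
  for q :: "'n::{finite,linorder} phase"
proof -
  define \<eta> where "\<eta> = jacobi_sol (a_seq q) (b_seq q) (nu i q) (- 1 / a_seq q 0) 0"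
  define s where "s = (\<Sum>k<CARD('n). \<eta> (Suc k) * eigenvec i q (Suc k))"
  have "(\<Sum>k<CARD('n). conjvec i q (Suc k) * eigenvec i q (Suc k)) = s - s / norm2 i q * norm2 i q"
    unfolding conjvec_def Let_def \<eta>_def[symmetric] s_def[symmetric]
    by (simp add: s_def norm2_def left_diff_distrib sum_subtractf sum_distrib_left mult.assoc)
  then show ?thesis using norm2_pos[of i q] by simp
qed

lemma wronskian_conjvec: "wronskian (a_seq q) (conjvec i q) (eigenvec i q) 0 = - 1"
  using a_seq_nz[of q 0]
  by (simp add: wronskian_def conjvec_def Let_def eigenvec_0 eigenvec_1)

lemma grad_nu:
  fixes q :: "'n::{finite,linorder} phase"
  assumes i: "i \<in> {1..CARD('n) - 1}"
  defines "u \<equiv> \<lambda>k. inverse (norm2 i q) * eigenvec i q k"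
  shows "grad (nu i) q = (site_vec (prod_a (a_seq q) u (eigenvec i q)), site_vec (prod_b u (eigenvec i q)))"
proof (rule grad_eq_site_vec)
  fix v :: "'n phase"
  obtain n where n: "CARD('n) = Suc n" by (rule CARD_eq_Suc)
  let ?y = "eigenvec i q"
  let ?da = "\<lambda>k. a_seq q k * fst v $ site (int k)" and ?db = "\<lambda>k. snd v $ site (int k)"
  have "((\<lambda>t. nu i (q + t *\<^sub>R v)) has_real_derivative
      first_variation (Suc n) ?da ?db ?y ?y / (\<Sum>k<Suc n. ?y (Suc k) * ?y (Suc k))) (at 0)"
    using eigenvalue_derivative[of "\<lambda>t. a_seq (q + t *\<^sub>R v)" ?da "\<lambda>t. b_seq (q + t *\<^sub>R v)" ?db
        "\<lambda>t. nu i (q + t *\<^sub>R v)" n, OF a_seq_deriv b_seq_deriv a_seq_nz nu_isCont[OF i]]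
    using nu_root[OF i] by (simp add: eigenvec_def n del: jacobi_sol.simps sum.lessThan_Suc)
  also have "first_variation (Suc n) ?da ?db ?y ?y / (\<Sum>k<Suc n. ?y (Suc k) * ?y (Suc k))
      = first_variation (Suc n) ?da ?db u ?y"
    unfolding u_def first_variation_scaleR by (simp add: norm2_def n divide_inverse del: sum.lessThan_Suc)
  also have "\<dots> = (\<Sum>k<CARD('n). prod_a (a_seq q) u ?y (Suc k) * fst v $ site (int (Suc k))
      + prod_b u ?y (Suc k) * snd v $ site (int (Suc k)))"
    using eigenvec_0[of i q] eigenvec_CARD[OF i, of q] unfolding n[symmetric]
    by (rule first_variation_eq_prod)
  finally show "((\<lambda>t. nu i (q + t *\<^sub>R v)) has_real_derivative
      (\<Sum>k<CARD('n). prod_a (a_seq q) u ?y (Suc k) * fst v $ site (int (Suc k))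
      + prod_b u ?y (Suc k) * snd v $ site (int (Suc k)))) (at 0)" .
qed

lemma grad_psi1:
  fixes q :: "'n::{finite,linorder} phase"
  assumes i: "i \<in> {1..CARD('n) - 1}"
  shows "grad (psi1 i) q = (site_vec (prod_a (a_seq q) (conjvec i q) (eigenvec i q)),
     site_vec (prod_b (conjvec i q) (eigenvec i q)))"
proof (rule grad_eq_site_vec)
  fix v :: "'n phase"
  obtain n where n: "CARD('n) = Suc n" by (rule CARD_eq_Suc)
  let ?y = "eigenvec i q" and ?u = "conjvec i q"
  let ?da = "\<lambda>k. a_seq q k * fst v $ site (int k)" and ?db = "\<lambda>k. snd v $ site (int k)"
  have root: "jacobi_sol (a_seq p) (b_seq p) (nu i p) 0 1 (Suc n) = 0" for p :: "'n phase"
    using nu_root[OF i, of p] by (simp only: n)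
  have q0: "q + 0 *\<^sub>R v = q" by simp
  have y: "eigenvec i q = jacobi_sol (a_seq (q + 0 *\<^sub>R v)) (b_seq (q + 0 *\<^sub>R v)) (nu i (q + 0 *\<^sub>R v)) 0 1"
    by (simp add: eigenvec_def)
  note eigenvalue_derivative[of "\<lambda>t. a_seq (q + t *\<^sub>R v)" ?da "\<lambda>t. b_seq (q + t *\<^sub>R v)" ?db
        "\<lambda>t. nu i (q + t *\<^sub>R v)" n, OF a_seq_deriv b_seq_deriv a_seq_nz nu_isCont[OF i] root]
  from norming_derivative[of "\<lambda>t. a_seq (q + t *\<^sub>R v)" ?da "\<lambda>t. b_seq (q + t *\<^sub>R v)" ?db
      "\<lambda>t. nu i (q + t *\<^sub>R v)" _ n ?u "(-1) ^ (CARD('n) - i)", OF a_seq_deriv b_seq_deriv a_seq_nz this root,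
      unfolded y[symmetric], unfolded q0]
  have "((\<lambda>t. ln ((-1) ^ (CARD('n) - i) * jacobi_sol (a_seq (q + t *\<^sub>R v)) (b_seq (q + t *\<^sub>R v))
      (nu i (q + t *\<^sub>R v)) 0 1 (Suc (Suc n)))) has_real_derivative
      first_variation (Suc n) ?da ?db ?u ?y) (at 0)"
    using conjvec_eq[of q i] conjvec_orth[of i q] wronskian_conjvec[of q i]
    by (simp add: n del: jacobi_sol.simps sum.lessThan_Suc)
  then have "((\<lambda>t. psi1 i (q + t *\<^sub>R v)) has_real_derivative
      first_variation (Suc n) ?da ?db ?u ?y) (at 0)"
    unfolding psi1_eq by (simp only: n)
  also have "first_variation (Suc n) ?da ?db ?u ?y
    = (\<Sum>k<CARD('n). prod_a (a_seq q) ?u ?y (Suc k) * fst v $ site (int (Suc k))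
      + prod_b ?u ?y (Suc k) * snd v $ site (int (Suc k)))"
    using eigenvec_0[of i q] eigenvec_CARD[OF i, of q] unfolding n[symmetric]
    by (rule first_variation_eq_prod)
  finally show "((\<lambda>t. psi1 i (q + t *\<^sub>R v)) has_real_derivative
      (\<Sum>k<CARD('n). prod_a (a_seq q) ?u ?y (Suc k) * fst v $ site (int (Suc k))
      + prod_b ?u ?y (Suc k) * snd v $ site (int (Suc k)))) (at 0)" .
qed

section \<open>The canonical relations\<close>

text \<open>
  Where the second factor vanishes, \<open>prod_a\<close> is the Wronskian of the two factors. As the
  eigenvectors vanish at \<open>0\<close> and \<open>N\<close> and the Wronskian is constant, the sequences close up
  periodically, which is the condition for replacing the form by the bracket.
\<close>

lemma wedge_products:
  fixes q :: "'n::{finite,linorder} phase"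
  assumes i: "i \<in> {1..CARD('n) - 1}" and j: "j \<in> {1..CARD('n) - 1}"
    and u: "jacobi_eq (a_seq q) (b_seq q) (nu i q) (\<lambda>_. 0) u"
    and w: "jacobi_eq (a_seq q) (b_seq q) (nu j q) (\<lambda>_. 0) w"
  defines "y \<equiv> eigenvec i q" and "z \<equiv> eigenvec j q"
  shows "wedge (site_vec (prod_a (a_seq q) u y), site_vec (prod_b u y) :: (real, 'n) vec)
       (site_vec (prod_a (a_seq q) w z), site_vec (prod_b w z))
     = bracket CARD('n) (prod_a (a_seq q) u y) (prod_b u y) (prod_a (a_seq q) w z) (prod_b w z)"
proof (rule wedge_site_vec)
  have periodic: "prod_a (a_seq q) f (eigenvec m q) 0 = prod_a (a_seq q) f (eigenvec m q) CARD('n)"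
    if m: "m \<in> {1..CARD('n) - 1}" and f: "jacobi_eq (a_seq q) (b_seq q) (nu m q) (\<lambda>_. 0) f" for f m
  proof -
    have "prod_a (a_seq q) f (eigenvec m q) k = wronskian (a_seq q) f (eigenvec m q) k"
      if "eigenvec m q k = 0" for k
      using that by (simp add: prod_a_def wronskian_def)
    then show ?thesis
      using eigenvec_0[of m q] eigenvec_CARD[OF m, of q] wronskian_constant[OF f eigenvec_eq, of "CARD('n)"]
      by simp
  qed
  show "prod_a (a_seq q) u y 0 = prod_a (a_seq q) u y CARD('n)"
    unfolding y_def by (rule periodic[OF i u])
  show "prod_a (a_seq q) w z 0 = prod_a (a_seq q) w z CARD('n)"
    unfolding z_def by (rule periodic[OF j w])
qed

text \<open>
  The eigenvectors \<open>y\<close> and \<open>z\<close> vanish at both ends, so one of the two products of Wronskians drops out of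
  the boundary values, and the other one becomes minus the product of the Wronskians of \<open>u, y\<close> and
  \<open>w, z\<close>. These are constant along the sites, so the two ends cancel.
\<close>

lemma wedge_products_distinct:
  fixes q :: "'n::{finite,linorder} phase"
  assumes i: "i \<in> {1..CARD('n) - 1}" and j: "j \<in> {1..CARD('n) - 1}" and ij: "i \<noteq> j"
    and u: "jacobi_eq (a_seq q) (b_seq q) (nu i q) (\<lambda>_. 0) u"
    and w: "jacobi_eq (a_seq q) (b_seq q) (nu j q) (\<lambda>_. 0) w"
  defines "y \<equiv> eigenvec i q" and "z \<equiv> eigenvec j q"
  shows "wedge (site_vec (prod_a (a_seq q) u y), site_vec (prod_b u y) :: (real, 'n) vec)
       (site_vec (prod_a (a_seq q) w z), site_vec (prod_b w z)) = 0"
proof -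
  let ?a = "a_seq q" and ?N = "CARD('n)"
  have y: "jacobi_eq ?a (b_seq q) (nu i q) (\<lambda>_. 0) y" and z: "jacobi_eq ?a (b_seq q) (nu j q) (\<lambda>_. 0) z"
    by (simp_all add: y_def z_def eigenvec_eq)
  have yk: "y 0 = 0" "y ?N = 0" and zk: "z 0 = 0" "z ?N = 0"
    using eigenvec_CARD[OF i, of q] eigenvec_CARD[OF j, of q] by (simp_all add: y_def z_def eigenvec_0)
  have split: "wronskian ?a u z k * wronskian ?a y w k = - wronskian ?a u y k * wronskian ?a w z k"
    if "y k = 0" "z k = 0" for k
    using that by (simp add: wronskian_def)
  have "(nu i q - nu j q) * bracket ?N (prod_a ?a u y) (prod_b u y) (prod_a ?a w z) (prod_b w z)
      = - wronskian ?a u y ?N * wronskian ?a w z ?N + wronskian ?a u y 0 * wronskian ?a w z 0"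
    unfolding bracket_products[OF u y w z] using yk zk split[of 0] split[of ?N]
    by (simp add: wronskian_def[of _ y z])
  also have "\<dots> = 0"
    using wronskian_constant[OF u y, of ?N] wronskian_constant[OF w z, of ?N] by simp
  finally have "bracket ?N (prod_a ?a u y) (prod_b u y) (prod_a ?a w z) (prod_b w z) = 0"
    using nu_inj[OF i j ij, of q] by simp
  then show ?thesis
    using wedge_products[OF i j u w] by (simp add: y_def z_def)
qed

lemma wedge_anticommute: "wedge g f = - wedge f g"
  unfolding wedge_def sum_negf[symmetric] by (intro sum.cong refl) (simp add: algebra_simps)

text \<open>
  Gradients with different indices are products at different eigenvalues and have bracket \<open>0\<close>. With
  equal indices two of the relations hold by antisymmetry, and the third one is \<open>- 2\<close> times the
  Wronskian \<open>- 1\<close>, since one factor of the gradient of the eigenvalue carries the inverse of the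
  squared norm.
\<close>

lemma canonical_relations:
  fixes q :: "'n::{finite,linorder} phase"
  assumes i: "i \<in> {1..CARD('n) - 1}" and j: "j \<in> {1..CARD('n) - 1}"
  shows "wedge (grad (nu i) q) (grad (nu j) q) = 0"
    and "wedge (grad (psi1 i) q) (grad (psi1 j) q) = 0"
    and "wedge (grad (psi1 i) q) (grad (nu j) q) = (if i = j then 2 else 0)"
proof -
  have self: "wedge f f = 0" for f :: "'n phase"
    using wedge_anticommute[of f f] by simp
  have scaled: "jacobi_eq (a_seq q) (b_seq q) (nu m q) (\<lambda>_. 0) (\<lambda>k. inverse (norm2 m q) * eigenvec m q k)" for m
    by (intro jacobi_eq_scale eigenvec_eq)
  show "wedge (grad (nu i) q) (grad (nu j) q) = 0"
    using self wedge_products_distinct[OF i j _ scaled scaled]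
    by (cases "i = j") (simp_all add: grad_nu[OF i] grad_nu[OF j])
  show "wedge (grad (psi1 i) q) (grad (psi1 j) q) = 0"
    using self wedge_products_distinct[OF i j _ conjvec_eq conjvec_eq]
    by (cases "i = j") (simp_all add: grad_psi1[OF i] grad_psi1[OF j])
  show "wedge (grad (psi1 i) q) (grad (nu j) q) = (if i = j then 2 else 0)"
  proof (cases "i = j")
    case True
    have "wedge (grad (psi1 i) q) (grad (nu i) q)
        = - 2 * wronskian (a_seq q) (conjvec i q) (eigenvec i q) 0 * (inverse (norm2 i q) * norm2 i q)"
      unfolding grad_psi1[OF i] grad_nu[OF i] wedge_products[OF i i conjvec_eq scaled]
        bracket_products_same_scaled[OF conjvec_eq eigenvec_eq] norm2_def[symmetric] ..
    also have "\<dots> = 2" using norm2_pos[of i q] by (simp add: wronskian_conjvec)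
    finally show ?thesis using True by simp
  next
    case False
    then show ?thesis
      using wedge_products_distinct[OF i j _ conjvec_eq scaled]
      by (simp add: grad_psi1[OF i] grad_nu[OF j])
  qed
qed

section \<open>The basis\<close>

lemma linear_wedge: "linear (wedge f)" for f :: "'n::{finite,linorder} phase"
  by (rule linearI)
     (simp_all add: wedge_def sum.distrib[symmetric] sum_distrib_left algebra_simps)

lemma independent_by_dual_functionals:
  fixes e :: "'i \<Rightarrow> 'v::real_vector" and L :: "'i \<Rightarrow> 'v \<Rightarrow> real"
  assumes lin: "\<And>i. i \<in> I \<Longrightarrow> linear (L i)"
    and diag: "\<And>i. i \<in> I \<Longrightarrow> L i (e i) \<noteq> 0"
    and off: "\<And>i j. i \<in> I \<Longrightarrow> j \<in> I \<Longrightarrow> i \<noteq> j \<Longrightarrow> L i (e j) = 0"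
  shows "inj_on e I" and "independent (e ` I)"
proof -
  show inj: "inj_on e I" by (rule inj_onI) (metis diag off)
  show "independent (e ` I)"
    unfolding dependent_def
  proof safe
    fix i assume i: "i \<in> I" and "e i \<in> span (e ` I - {e i})"
    moreover have "L i x = 0" if "x \<in> e ` I - {e i}" for x
      using that off[OF i] by auto
    ultimately have "L i (e i) = 0"
      using linear_eq_0_on_span[OF lin[OF i]] by blast
    with diag[OF i] show False by simp
  qed
qed

lemma
  shows subspace_H2: "subspace (H2 :: 'n::{finite,linorder} phase set)"
    and dim_H2: "dim (H2 :: 'n phase set) = 2 * (CARD('n) - 1)"
proof -
  have H: "(H :: (real, 'n) vec set) = {b. (\<chi> i. 1) \<bullet> b = 0}"
    by (simp add: H_def inner_vec_def)
  have "(\<chi> i. 1) \<noteq> (0 :: (real, 'n) vec)"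
    by (simp add: vec_eq_iff)
  then have "dim (H :: (real, 'n) vec set) = CARD('n) - 1"
    unfolding H by (subst dim_hyperplane) simp_all
  moreover have sub: "subspace (H :: (real, 'n) vec set)"
    unfolding H by (rule subspace_hyperplane)
  ultimately show "dim (H2 :: 'n phase set) = 2 * (CARD('n) - 1)"
    by (simp add: H2_def dim_Times)
  show "subspace (H2 :: 'n phase set)"
    unfolding H2_def by (intro subspace_Times sub)
qed

lemma grad_nu_psi1_H2:
  fixes q :: "'n::{finite,linorder} phase"
  assumes "i \<in> {1..CARD('n) - 1}"
  shows "grad (nu i) q \<in> H2" and "grad (psi1 i) q \<in> H2"
  by (simp_all add: grad_nu[OF assms] grad_psi1[OF assms] H2_def site_vec_H)

text \<open>
  By the canonical relations each gradient of an eigenvalue is detected by the wedge with the gradient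
  of the norming constant of the same index, and conversely. So the gradients are independent, and
  their number is the dimension of \<open>H2\<close>.
\<close>

lemma basis_grads:
  fixes q :: "'n::{finite,linorder} phase"
  defines "I \<equiv> {1..CARD('n) - 1}"
  shows "basis_family (I <+> I) (case_sum (\<lambda>n. grad (nu n) q) (\<lambda>n. grad (psi1 n) q)) H2"
proof -
  define e where "e = case_sum (\<lambda>n. grad (nu n) q) (\<lambda>n. grad (psi1 n) q)"
  define L where "L = case_sum (\<lambda>n. wedge (grad (psi1 n) q)) (\<lambda>n. wedge (grad (nu n) q))"
  have nu_psi: "wedge (grad (nu i) q) (grad (psi1 j) q) = (if i = j then - 2 else 0)"
    if "i \<in> I" "j \<in> I" for i j
    using canonical_relations(3)[of j i q] that
    by (subst wedge_anticommute) (auto simp: I_def)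
  note rel = nu_psi canonical_relations[of _ _ q, folded I_def]
  have "linear (L i)" for i by (cases i) (simp_all add: L_def linear_wedge)
  moreover have "L i (e i) \<noteq> 0" if "i \<in> I <+> I" for i
    using that by (auto simp: L_def e_def rel)
  moreover have "L i (e j) = 0" if "i \<in> I <+> I" "j \<in> I <+> I" "i \<noteq> j" for i j
    using that by (auto simp: L_def e_def rel split: if_splits)
  ultimately have inj: "inj_on e (I <+> I)" and ind: "independent (e ` (I <+> I))"
    using independent_by_dual_functionals[of "I <+> I" L e] by blast+
  have sub: "e ` (I <+> I) \<subseteq> H2"
    using grad_nu_psi1_H2[of _ q, folded I_def] by (auto simp: e_def)
  have "card (e ` (I <+> I)) = dim (H2 :: 'n phase set)"
    unfolding card_image[OF inj] by (simp add: card_Plus I_def dim_H2)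
  then have "H2 \<subseteq> span (e ` (I <+> I))"
    using card_ge_dim_independent[OF sub ind] by simp
  moreover have "span (e ` (I <+> I)) \<subseteq> H2"
    using span_minimal[OF sub subspace_H2] .
  ultimately show ?thesis
    unfolding basis_family_def e_def[symmetric] using inj ind by auto
qed

theorem theorem1p3:
  fixes q :: "'n::{finite,linorder} phase"
  assumes "q \<in> H2"
  shows "(\<forall>n\<in>{1..CARD('n) - 1}. \<forall>m\<in>{1..CARD('n) - 1}.
            wedge (grad (nu n) q) (grad (nu m) q) = 0 \<and>
            wedge (grad (psi1 n) q) (grad (psi1 m) q) = 0 \<and>
            wedge (grad (psi1 n) q) (grad (nu m) q) = (if n = m then 2 else 0)) \<and>
         basis_family ({1..CARD('n) - 1} <+> {1..CARD('n) - 1})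
           (case_sum (\<lambda>n. grad (nu n) q) (\<lambda>n. grad (psi1 n) q))
           (H2 :: 'n phase set)"
  using canonical_relations[of _ _ q] basis_grads[of q] by blast

end
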